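(* Let $\mathbb{G}_{\mathrm{LEO}}$ be the subset of $\mathbb{G}$ whose elements are locally eventually onto (LEO). Then $\mathbb{G}_{\mathrm{LEO}}$ is dense in $C(\lambda)$ with respect to the uniform metric $\rho$.
   Context: $\lambda$ is Lebesgue measure on $[0,1]$. A continuous map $h:[0,1]\to[0,1]$ is $\lambda$-preserving if $\lambda(A)=\lambda(h^{-1}(A))$ for every Borel set $A\subseteq[0,1]$. $C(\lambda)$ is the set of all continuous $\lambda$-preserving maps $[0,1]\to[0,1]$. The metric is $\rho(h_1,h_2)=\sup_{x\in[0,1]}|h_1(x)-h_2(x)|$. A dyadic number is a rational number whose denominator is an integer power of $2$. $\mathbb{G}$ ($\lambda$-preserving Thompson's monoid) is the set of continuous maps $g$ from $[0,1]$ onto $[0,1]$ such that: $g$ is $\lambda$-preserving; $g$ is piecewise affine; $g$ is differentiable except at finitely many points; the $x$-coordinate of each point of non-differentiability is dyadic; and on every interval where $g$ is differentiable, the derivative is of the form $\pm 2^k$ with $k\in\mathbb{Z}$. An interval map $h$ is locally eventually onto (LEO) if for every nonempty open set $U$ in $[0,1]$ there is an integer $N$ such that $h^N(U)=[0,1]$, where $h^N$ is the $N$-fold iterate. *)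

theory Defs
  imports "HOL-Analysis.Analysis"
begin

text \<open>
  Maps of the unit interval are functions in \<^term>\<open>{0..1} \<rightarrow>\<^sub>E {0..1::real}\<close>: they are pinned to
  \<^term>\<open>undefined\<close> outside \<^term>\<open>{0..1::real}\<close>, so that equal maps are equal functions and the
  supremum distance is a metric. Preimages and derivatives are therefore taken relative to
  \<^term>\<open>{0..1::real}\<close>.
\<close>

definition lambda_preserving :: "(real \<Rightarrow> real) \<Rightarrow> bool" where
  "lambda_preserving h \<longleftrightarrow>
     (\<forall>A \<in> sets borel. A \<subseteq> {0..1} \<longrightarrow> emeasure lborel A = emeasure lborel (h -` A \<inter> {0..1}))"

definition C_lambda :: "(real \<Rightarrow> real) set" where
  "C_lambda = {h \<in> {0..1} \<rightarrow>\<^sub>E {0..1}. continuous_on {0..1} h \<and> lambda_preserving h}"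

definition C_lambda_metric :: "(real \<Rightarrow> real) metric" where
  "C_lambda_metric = submetric (cfunspace (top_of_set {0..1}) euclidean_metric) C_lambda"

text \<open>The library constant \<^const>\<open>dyadics\<close> contains only the nonnegative dyadic rationals.\<close>

definition dyadic_numbers :: "real set" where
  "dyadic_numbers = {of_int m / 2 ^ n | (m :: int) (n :: nat). True}"

definition piecewise_affine :: "(real \<Rightarrow> real) \<Rightarrow> bool" where
  "piecewise_affine g \<longleftrightarrow>
     (\<exists>(n :: nat) t. t 0 = 0 \<and> t n = 1 \<and>
        (\<forall>i<n. t i < t (Suc i) \<and> (\<exists>a b. \<forall>x \<in> {t i..t (Suc i)}. g x = a * x + b)))"

text \<open>Differentiability at the endpoints 0 and 1 is one-sided.\<close>

definition nondiff_points :: "(real \<Rightarrow> real) \<Rightarrow> real set" where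
  "nondiff_points g = {x \<in> {0..1}. \<not> g differentiable (at x within {0..1})}"

definition thompson_monoid :: "(real \<Rightarrow> real) set" where
  "thompson_monoid = {g \<in> {0..1} \<rightarrow>\<^sub>E {0..1}.
     continuous_on {0..1} g \<and> g ` {0..1} = {0..1} \<and>
     lambda_preserving g \<and>
     piecewise_affine g \<and>
     finite (nondiff_points g) \<and>
     nondiff_points g \<subseteq> dyadic_numbers \<and>
     (\<forall>a b. 0 \<le> a \<and> a < b \<and> b \<le> 1 \<and> (\<forall>x \<in> {a<..<b}. g differentiable (at x)) \<longrightarrow>
        (\<exists>(k :: int) s. s \<in> {1, -1} \<and>
           (\<forall>x \<in> {a<..<b}. (g has_real_derivative s * 2 powi k) (at x))))}"

definition LEO :: "(real \<Rightarrow> real) \<Rightarrow> bool" where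
  "LEO h \<longleftrightarrow>
     (\<forall>U. openin (top_of_set {0..1}) U \<and> U \<noteq> {} \<longrightarrow> (\<exists>N :: nat. (h ^^ N) ` U = {0..1}))"

definition thompson_monoid_LEO :: "(real \<Rightarrow> real) set" where
  "thompson_monoid_LEO = {g \<in> thompson_monoid. LEO g}"

lemma C_lambda_subset_cfunspace:
  "C_lambda \<subseteq> mspace (cfunspace (top_of_set {0..1}) euclidean_metric)"
proof
  fix h assume "h \<in> C_lambda"
  then have h: "h \<in> {0..1} \<rightarrow>\<^sub>E {0..1}" and c: "continuous_on {0..1} h"
    by (auto simp: C_lambda_def)
  have "bounded (h ` {0..1})"
    using c compact_continuous_image compact_imp_bounded by blast
  then show "h \<in> mspace (cfunspace (top_of_set {0..1}) euclidean_metric)"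
    using h c by (auto simp: PiE_def extensional_def)
qed

lemma mspace_C_lambda_metric: "mspace C_lambda_metric = C_lambda"
  using C_lambda_subset_cfunspace by (auto simp: C_lambda_metric_def simp del: mspace_cfunspace)

lemma mdist_C_lambda_metric:
  assumes "h1 \<in> C_lambda" "h2 \<in> C_lambda"
  shows "mdist C_lambda_metric h1 h2 = (SUP x\<in>{0..1}. \<bar>h1 x - h2 x\<bar>)"
proof -
  have "h \<in> extensional {0..1} \<and> bounded (h ` {0..1})" if "h \<in> C_lambda" for h
    using that C_lambda_subset_cfunspace by fastforce
  then have "h1 \<in> Met_TC.fspace {0..1}" "h2 \<in> Met_TC.fspace {0..1}"
    using assms by (auto simp: Met_TC.fspace_def)
  then show ?thesis
    by (simp add: C_lambda_metric_def Met_TC.fdist_def dist_real_def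
        mdist_cfunspace_eq_mdist_funspace mdist_funspace)
qed

lemma thompson_monoid_subset_C_lambda: "thompson_monoid \<subseteq> C_lambda"
  by (auto simp: thompson_monoid_def C_lambda_def)

end

theory Submission
  imports Defs
begin

text \<open>
  Let \<open>f\<close> be continuous and measure preserving, \<open>M = 2\<^sup>m\<close>, and \<open>N = 2\<^sup>n\<close> so large that \<open>f\<close> varies by
  less than \<open>1/M\<close> on scale \<open>3/N\<close>. Let \<open>a i j\<close> be the measure of the points of the \<open>i\<close>-th interval of
  length \<open>1/N\<close> that \<open>f\<close> maps into the \<open>j\<close>-th cell of length \<open>1/M\<close>; the rows of \<open>a\<close> sum to \<open>1/N\<close>, the
  columns to \<open>1/M\<close>. Spreading every row to the neighbouring cells keeps these sums and makes the
  support of each row a block of consecutive cells, and two adjacent columns always meet in a common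
  row. Rounding the cumulative row sums down to multiples of a small \<open>1/2\<^sup>q\<close>, and putting the total
  error of each column boundary into one such common row, gives a dyadic matrix with the same row
  and column sums and the same support. A nearest-neighbour walk through the multiples of \<open>1/M\<close> can
  spend exactly the prescribed time in each cell, in steps of duration \<open>1/2\<^sup>q\<close> or half of it; its
  polygonal graph is a measure-preserving Thompson map close to \<open>f\<close>.

  The polygonal map is locally eventually onto: its slopes are at least 4 in absolute value, so
  iterates of an interval grow until they contain a whole linear piece and then a cell. A union of
  cells \<open>T\<close> has an image under \<open>f\<close> of at least the measure of \<open>T\<close>, and the spreading step adds a
  neighbouring cell, so the number of cells grows until everything is covered.
\<close>

subsection \<open>Nearest-neighbour walks with prescribed occupation times\<close>

fun chain :: "'a \<Rightarrow> ('a \<times> 'a) list \<Rightarrow> 'a \<Rightarrow> bool" where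
  "chain p [] q \<longleftrightarrow> p = q"
| "chain p (e # es) q \<longleftrightarrow> fst e = p \<and> chain (snd e) es q"

lemma chain_append: "chain p (xs @ ys) r \<longleftrightarrow> (\<exists>q. chain p xs q \<and> chain q ys r)"
  by (induction xs arbitrary: p) auto

lemma chain_nth:
  assumes "chain p es q"
  shows "\<exists>P. P 0 = p \<and> P (length es) = q \<and> (\<forall>k<length es. es ! k = (P k, P (Suc k)))"
  using assms
proof (induction es arbitrary: p)
  case (Cons e es)
  then obtain P where P: "P 0 = snd e" "P (length es) = q" "\<forall>k<length es. es ! k = (P k, P (Suc k))"
    by auto
  have "(e # es) ! k = (case_nat p P k, case_nat p P (Suc k))" if "k < length (e # es)" for k
    using that P Cons.prems by (cases k) auto
  moreover have "case_nat p P 0 = p" "case_nat p P (length (e # es)) = q"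
    using P by auto
  ultimately show ?case by blast
qed auto

text \<open>Points are pairs of a time and a height counted in cells, so an edge between adjacent
  heights crosses exactly the cell indexed by the lower one.\<close>

type_synonym edge = "(real \<times> nat) \<times> (real \<times> nat)"

definition edge_dur :: "edge \<Rightarrow> real" where
  "edge_dur e = fst (snd e) - fst (fst e)"

definition edge_level :: "edge \<Rightarrow> nat" where
  "edge_level e = min (snd (fst e)) (snd (snd e))"

definition adjacent :: "nat \<Rightarrow> nat \<Rightarrow> bool" where
  "adjacent a b \<longleftrightarrow> b = Suc a \<or> a = Suc b"

definition edge_ok :: "real \<Rightarrow> edge \<Rightarrow> bool" where
  "edge_ok d e \<longleftrightarrow> edge_dur e \<in> {d, d / 2} \<and> adjacent (snd (fst e)) (snd (snd e))"

definition level_time :: "nat \<Rightarrow> edge list \<Rightarrow> real" where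
  "level_time j es = (\<Sum>e\<leftarrow>es. if edge_level e = j then edge_dur e else 0)"

lemma level_time_Nil [simp]: "level_time j [] = 0"
  and level_time_Cons [simp]:
    "level_time j (e # es) = (if edge_level e = j then edge_dur e else 0) + level_time j es"
  and level_time_append [simp]: "level_time j (es @ es') = level_time j es + level_time j es'"
  by (auto simp: level_time_def)

lemma level_time_nonneg:
  assumes "0 < d" "\<forall>e\<in>set es. edge_ok d e"
  shows "0 \<le> level_time j es"
  using assms(2) by (induction es) (use assms(1) in \<open>auto simp: edge_ok_def\<close>)

lemma level_time_pos:
  assumes "0 < d" "\<forall>e\<in>set es. edge_ok d e" "e \<in> set es"
  shows "0 < level_time (edge_level e) es"
  using assms(2,3)
proof (induction es)
  case (Cons e' es)
  have "0 \<le> level_time j es" for j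
    using Cons.prems assms(1) level_time_nonneg by auto
  moreover have "0 < edge_dur e'"
    using Cons.prems assms(1) by (auto simp: edge_ok_def)
  ultimately show ?case
    using Cons by (auto simp: add_pos_nonneg add_nonneg_pos)
qed auto

lemma level_time_pos_ex:
  assumes "0 < level_time j es"
  shows "\<exists>e\<in>set es. edge_level e = j"
  using assms by (induction es) (auto split: if_splits)

text \<open>The durations telescope along the chain, and every edge is counted in exactly one level
  below \<open>n\<close>. This recovers the total time of a walk from its occupation times.\<close>

lemma chain_time:
  assumes "chain p es q" "\<forall>e\<in>set es. edge_level e < n"
  shows "fst q - fst p = (\<Sum>j<n. level_time j es)"
  using assms
proof (induction es arbitrary: p)
  case (Cons e es)
  have "(\<Sum>j<n. level_time j (e # es)) = edge_dur e + (\<Sum>j<n. level_time j es)"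
    using Cons.prems by (simp add: sum.distrib)
  also have "\<dots> = edge_dur e + (fst q - fst (snd e))"
    using Cons by auto
  finally show ?case using Cons.prems by (auto simp: edge_dur_def)
qed auto

lemma chain_times_between:
  assumes "0 < d" "chain p es q" "\<forall>e\<in>set es. edge_ok d e"
  shows "fst p \<le> fst q" "\<forall>e\<in>set es. fst p \<le> fst (fst e) \<and> fst (snd e) \<le> fst q"
proof -
  have "fst p \<le> fst q \<and> (\<forall>e\<in>set es. fst p \<le> fst (fst e) \<and> fst (snd e) \<le> fst q)"
    using assms(2,3)
  proof (induction es arbitrary: p)
    case (Cons e es)
    have "fst (fst e) < fst (snd e)"
      using Cons.prems assms(1) by (auto simp: edge_ok_def edge_dur_def)
    then show ?case using Cons.prems Cons.IH[of "snd e"] by fastforce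
  qed auto
  then show "fst p \<le> fst q" "\<forall>e\<in>set es. fst p \<le> fst (fst e) \<and> fst (snd e) \<le> fst q" by auto
qed

section \<open>Routes between two heights with given occupation times\<close>

text \<open>\<open>c j\<close> is the time spent in cell \<open>j\<close> in units of \<open>d\<close>.\<close>

definition reach :: "real \<Rightarrow> (nat \<Rightarrow> nat) \<Rightarrow> nat \<Rightarrow> nat \<Rightarrow> bool" where
  "reach d c a b \<longleftrightarrow> (\<forall>s. \<exists>es t. chain (s, a) es (t, b) \<and> (\<forall>e\<in>set es. edge_ok d e) \<and>
     (\<forall>j. level_time j es = c j * d))"

lemma reach_refl: "reach d (\<lambda>_. 0) a a"
  unfolding reach_def by (auto intro!: exI[of _ "[]"])

lemma reach_trans:
  assumes "reach d c a b" "reach d c' b b'"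
  shows "reach d (\<lambda>j. c j + c' j) a b'"
  unfolding reach_def
proof
  fix s
  obtain es t where 1: "chain (s, a) es (t, b)" "\<forall>e\<in>set es. edge_ok d e" "\<forall>j. level_time j es = c j * d"
    using assms(1) unfolding reach_def by blast
  obtain es' t' where 2: "chain (t, b) es' (t', b')" "\<forall>e\<in>set es'. edge_ok d e"
      "\<forall>j. level_time j es' = c' j * d"
    using assms(2) unfolding reach_def by blast
  show "\<exists>es t. chain (s, a) es (t, b') \<and> (\<forall>e\<in>set es. edge_ok d e) \<and>
      (\<forall>j. level_time j es = real (c j + c' j) * d)"
    using 1 2 by (intro exI[of _ "es @ es'"] exI[of _ t']) (auto simp: chain_append algebra_simps)
qed

text \<open>A crossing takes an odd number of steps, so for even \<open>n\<close> one unit is split into two halves.\<close>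

lemma reach_cross:
  assumes "adjacent a b" "1 \<le> n"
  shows "reach d (\<lambda>j. if j = min a b then n else 0) a b"
  using assms(2)
proof (induction n rule: less_induct)
  case (less n)
  have ba: "adjacent b a" and mm: "min b a = min a b" using assms(1) by (auto simp: adjacent_def)
  have one: "reach d (\<lambda>j. if j = min a b then 1 else 0) a b"
    if "adjacent a b" for a b
    unfolding reach_def
  proof
    fix s
    show "\<exists>es t. chain (s, a) es (t, b) \<and> (\<forall>e\<in>set es. edge_ok d e) \<and>
        (\<forall>j. level_time j es = real (if j = min a b then 1 else 0) * d)"
      using that
      by (intro exI[of _ "[((s, a), (s + d, b))]"] exI[of _ "s + d"])
         (auto simp: edge_ok_def edge_dur_def edge_level_def)
  qed
  consider "n = 1" | "n = 2" | "3 \<le> n" using less.prems by linarith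
  then show ?case
  proof cases
    case 1
    then show ?thesis using one[OF assms(1)] by presburger
  next
    case 2
    show ?thesis unfolding reach_def
    proof
      fix s
      show "\<exists>es t. chain (s, a) es (t, b) \<and> (\<forall>e\<in>set es. edge_ok d e) \<and>
          (\<forall>j. level_time j es = real (if j = min a b then n else 0) * d)"
        using assms(1) ba 2
        by (intro exI[of _ "[((s, a), (s + d, b)), ((s + d, b), (s + d + d / 2, a)),
                              ((s + d + d / 2, a), (s + d + d / 2 + d / 2, b))]"]
              exI[of _ "s + d + d / 2 + d / 2"])
           (auto simp: edge_ok_def edge_dur_def edge_level_def mm)
    qed
  next
    case 3
    \<comment> \<open>One round trip from \<open>a\<close> to \<open>b\<close> and back uses two
      units, which reduces \<open>n\<close> to \<open>n - 2\<close>.\<close>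
    have "reach d (\<lambda>j. (if j = min a b then 1 else 0) + (if j = min b a then 1 else 0)) a a"
      using reach_trans[OF one[OF assms(1)] one[OF ba]] .
    from reach_trans[OF this less.IH[of "n - 2"]] 3
    have "reach d (\<lambda>j. (if j = min a b then 1 else 0) + (if j = min b a then 1 else 0) +
        (if j = min a b then n - 2 else 0)) a b" by auto
    moreover have "(\<lambda>j. (if j = min a b then 1 else 0) + (if j = min b a then 1 else 0) +
        (if j = min a b then n - 2 else 0)) = (\<lambda>j. if j = min a b then n else 0)"
      using 3 by (auto simp: mm fun_eq_iff)
    ultimately show ?thesis by simp
  qed
qed

lemma reach_up:
  assumes "a \<le> b" "\<And>j. a \<le> j \<Longrightarrow> j < b \<Longrightarrow> 1 \<le> c j"
  shows "reach d (\<lambda>j. if a \<le> j \<and> j < b then c j else 0) a b"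
  using assms
proof (induction b rule: dec_induct)
  case base
  have "(\<lambda>j. if a \<le> j \<and> j < a then c j else 0) = (\<lambda>_. 0)" by auto
  then show ?case using reach_refl[of d a] by simp
next
  case (step n)
  have "reach d (\<lambda>j. (if a \<le> j \<and> j < n then c j else 0) + (if j = min n (Suc n) then c n else 0)) a (Suc n)"
    using step.IH step.prems step.hyps
    by (intro reach_trans[where b = n] reach_cross) (auto simp: adjacent_def)
  moreover have "(\<lambda>j. (if a \<le> j \<and> j < n then c j else 0) + (if j = min n (Suc n) then c n else 0)) =
      (\<lambda>j. if a \<le> j \<and> j < Suc n then c j else 0)"
    using step by (auto simp: fun_eq_iff)
  ultimately show ?case by simp
qed

lemma reach_down:
  assumes "a \<le> b" "\<And>j. a \<le> j \<Longrightarrow> j < b \<Longrightarrow> 1 \<le> c j"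
  shows "reach d (\<lambda>j. if a \<le> j \<and> j < b then c j else 0) b a"
  using assms
proof (induction b rule: dec_induct)
  case base
  have "(\<lambda>j. if a \<le> j \<and> j < a then c j else 0) = (\<lambda>_. 0)" by auto
  then show ?case using reach_refl[of d a] by simp
next
  case (step n)
  have "reach d (\<lambda>j. (if j = min (Suc n) n then c n else 0) + (if a \<le> j \<and> j < n then c j else 0)) (Suc n) a"
    using step.IH step.prems step.hyps
    by (intro reach_trans[where b = n] reach_cross) (auto simp: adjacent_def)
  moreover have "(\<lambda>j. (if j = min (Suc n) n then c n else 0) + (if a \<le> j \<and> j < n then c j else 0)) =
      (\<lambda>j. if a \<le> j \<and> j < Suc n then c j else 0)"
    using step by (auto simp: fun_eq_iff)
  ultimately show ?case by simp
qed

text \<open>An excursion crosses every cell on its way twice. One unit is spent going out and the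
  remaining \<open>c j - 1\<close> coming back, so two units per cell suffice.\<close>

lemma reach_excursion_up:
  assumes "a \<le> b" "\<And>j. a \<le> j \<Longrightarrow> j < b \<Longrightarrow> 2 \<le> c j"
  shows "reach d (\<lambda>j. if a \<le> j \<and> j < b then c j else 0) a a"
proof -
  have "reach d (\<lambda>j. (if a \<le> j \<and> j < b then 1 else 0) + (if a \<le> j \<and> j < b then c j - 1 else 0)) a a"
    by (intro reach_trans[where b = b] reach_up[where c = "\<lambda>_. 1"] reach_down)
       (use assms in \<open>force simp: Suc_le_eq\<close>)+
  moreover have "(\<lambda>j. (if a \<le> j \<and> j < b then 1 else 0) + (if a \<le> j \<and> j < b then c j - 1 else 0)) =
      (\<lambda>j. if a \<le> j \<and> j < b then c j else 0)"
    using assms by (force simp: fun_eq_iff)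
  ultimately show ?thesis by simp
qed

lemma reach_excursion_down:
  assumes "a \<le> b" "\<And>j. a \<le> j \<Longrightarrow> j < b \<Longrightarrow> 2 \<le> c j"
  shows "reach d (\<lambda>j. if a \<le> j \<and> j < b then c j else 0) b b"
proof -
  have "reach d (\<lambda>j. (if a \<le> j \<and> j < b then 1 else 0) + (if a \<le> j \<and> j < b then c j - 1 else 0)) b b"
    by (intro reach_trans[where b = a] reach_down[where c = "\<lambda>_. 1"] reach_up)
       (use assms in \<open>force simp: Suc_le_eq\<close>)+
  moreover have "(\<lambda>j. (if a \<le> j \<and> j < b then 1 else 0) + (if a \<le> j \<and> j < b then c j - 1 else 0)) =
      (\<lambda>j. if a \<le> j \<and> j < b then c j else 0)"
    using assms by (force simp: fun_eq_iff)
  ultimately show ?thesis by simp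
qed

text \<open>For \<open>u \<le> v\<close> the walk dips from \<open>u\<close> to \<open>lo\<close>
  and returns, climbs once to \<open>v\<close>, then makes an excursion to \<open>hi\<close> and
  returns; for \<open>u > v\<close> the picture is mirrored. Thus cells outside the segment between
  \<open>u\<close> and \<open>v\<close> are served as well.\<close>

lemma reach_tour:
  assumes u: "lo \<le> u" "u \<le> hi" and v: "lo \<le> v" "v \<le> hi"
    and c: "\<And>j. lo \<le> j \<Longrightarrow> j < hi \<Longrightarrow> 2 \<le> c j" and c0: "\<And>j. \<not> (lo \<le> j \<and> j < hi) \<Longrightarrow> c j = 0"
  shows "reach d c u v"
proof (cases "u \<le> v")
  case True
  have c1: "1 \<le> c j" if "lo \<le> j" "j < hi" for j using c[OF that] by simp
  have "reach d (\<lambda>j. (if lo \<le> j \<and> j < u then c j else 0) + (if u \<le> j \<and> j < v then c j else 0) +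
     (if v \<le> j \<and> j < hi then c j else 0)) u v"
    using True u v
    by (intro reach_trans[where b = v] reach_trans[where a = u and b = u]
          reach_up reach_excursion_up reach_excursion_down c c1) auto
  moreover have "(\<lambda>j. (if lo \<le> j \<and> j < u then c j else 0) + (if u \<le> j \<and> j < v then c j else 0) +
     (if v \<le> j \<and> j < hi then c j else 0)) = c"
    using True u v c0 by (auto simp: fun_eq_iff)
  ultimately show ?thesis by simp
next
  case False
  have c1: "1 \<le> c j" if "lo \<le> j" "j < hi" for j using c[OF that] by simp
  have "reach d (\<lambda>j. (if u \<le> j \<and> j < hi then c j else 0) + (if v \<le> j \<and> j < u then c j else 0) +
     (if lo \<le> j \<and> j < v then c j else 0)) u v"
    using False u v
    by (intro reach_trans[where b = v and b' = v] reach_trans[where a = u and b = u]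
          reach_down reach_excursion_up reach_excursion_down c c1) auto
  moreover have "(\<lambda>j. (if u \<le> j \<and> j < hi then c j else 0) + (if v \<le> j \<and> j < u then c j else 0) +
     (if lo \<le> j \<and> j < v then c j else 0)) = c"
    using False u v c0 by (auto simp: fun_eq_iff)
  ultimately show ?thesis by simp
qed

text \<open>Row \<open>i\<close> of \<open>c\<close> governs the time slot from \<open>i * w\<close>
  to \<open>(i + 1) * w\<close>. The last two conjuncts link edges and rows in both directions: that
  each edge comes from a positive entry of the row of its slot gives closeness to the original map,
  and that each positive entry produces an edge in its slot gives growth under iteration.\<close>

lemma reach_concat:
  fixes w :: real
  assumes d: "0 < d"
    and r: "\<And>i. i < N \<Longrightarrow> reach d (c i) (u i) (u (Suc i))"
    and c0: "\<And>i j. i < N \<Longrightarrow> M \<le> j \<Longrightarrow> c i j = 0"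
    and row: "\<And>i. i < N \<Longrightarrow> real (\<Sum>j<M. c i j) * d = w"
    and "k \<le> N"
  shows "\<exists>es. chain (0, u 0) es (k * w, u k) \<and> (\<forall>e\<in>set es. edge_ok d e) \<and>
    (\<forall>j. level_time j es = (\<Sum>i<k. c i j * d)) \<and>
    (\<forall>e\<in>set es. \<exists>i<k. i * w \<le> fst (fst e) \<and> fst (snd e) \<le> Suc i * w \<and> 0 < c i (edge_level e)) \<and>
    (\<forall>i<k. \<forall>j. 0 < c i j \<longrightarrow> (\<exists>e\<in>set es. i * w \<le> fst (fst e) \<and> fst (snd e) \<le> Suc i * w \<and> edge_level e = j))"
  using \<open>k \<le> N\<close>
proof (induction k)
  case 0
  show ?case by (intro exI[of _ "[]"]) auto
next
  case (Suc k)
  then obtain es where es: "chain (0, u 0) es (k * w, u k)" "\<forall>e\<in>set es. edge_ok d e"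
    "\<forall>j. level_time j es = (\<Sum>i<k. c i j * d)"
    "\<forall>e\<in>set es. \<exists>i<k. i * w \<le> fst (fst e) \<and> fst (snd e) \<le> Suc i * w \<and> 0 < c i (edge_level e)"
    "\<forall>i<k. \<forall>j. 0 < c i j \<longrightarrow> (\<exists>e\<in>set es. i * w \<le> fst (fst e) \<and> fst (snd e) \<le> Suc i * w \<and> edge_level e = j)"
    by auto
  have kN: "k < N" using Suc.prems by simp
  obtain es' t where es': "chain (k * w, u k) es' (t, u (Suc k))" "\<forall>e\<in>set es'. edge_ok d e"
    "\<forall>j. level_time j es' = c k j * d"
    using r[OF kN] unfolding reach_def by blast
  have pos: "0 < c k (edge_level e)" if "e \<in> set es'" for e
    using level_time_pos[OF d es'(2) that] es'(3) d by (simp add: zero_less_mult_iff)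
  \<comment> \<open>\<open>reach\<close> leaves the final time open; the row sum fixes it, since all
    levels of \<open>es'\<close> are below \<open>M\<close>.\<close>
  have "t - k * w = (\<Sum>j<M. level_time j es')"
    using chain_time[OF es'(1), of M] pos c0[OF kN] by (metis fst_conv not_le_imp_less less_numeral_extra(3))
  also have "\<dots> = w" using row[OF kN] es'(3) by (simp add: sum_distrib_right)
  finally have t: "t = Suc k * w" by (simp add: algebra_simps)
  have btw: "k * w \<le> fst (fst e) \<and> fst (snd e) \<le> Suc k * w" if "e \<in> set es'" for e
    using chain_times_between(2)[OF d es'(1,2)] that t by auto
  have "chain (0, u 0) (es @ es') (Suc k * w, u (Suc k))"
    using es(1) es'(1) t by (auto simp: chain_append)
  moreover have "\<forall>e\<in>set (es @ es'). edge_ok d e" using es es' by auto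
  moreover have "\<forall>j. level_time j (es @ es') = (\<Sum>i<Suc k. c i j * d)" using es es' by auto
  moreover have "\<exists>i<Suc k. i * w \<le> fst (fst e) \<and> fst (snd e) \<le> Suc i * w \<and> 0 < c i (edge_level e)"
    if "e \<in> set (es @ es')" for e
    using that es(4) btw[of e] pos[of e] by (auto simp del: of_nat_Suc intro: less_SucI)
  moreover have "\<exists>e\<in>set (es @ es'). i * w \<le> fst (fst e) \<and> fst (snd e) \<le> Suc i * w \<and> edge_level e = j"
    if ij: "i < Suc k" "0 < c i j" for i j
  proof (cases "i = k")
    case True
    then have "0 < level_time j es'" using es'(3) ij d by simp
    then show ?thesis using level_time_pos_ex btw True by fastforce
  next
    case False
    then have "i < k" using ij by simp
    then show ?thesis using es(5) ij by (metis UnCI set_append)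
  qed
  ultimately show ?case by blast
qed

subsection \<open>Polygonal maps\<close>

lemma measure_Int_Ico:
  assumes "B \<in> sets borel"
  shows "measure lborel (B \<inter> {a..<b}) = measure lborel (B \<inter> {a..b::real})"
proof (rule measure_eq_AE)
  show "AE x in lborel. (x \<in> B \<inter> {a..<b}) = (x \<in> B \<inter> {a..b})"
    using AE_lborel_singleton[of b] by eventually_elim auto
qed (use assms in auto)

text \<open>Half-open pieces are disjoint, so the measures add exactly. Partitioning the values of
  \<open>f\<close> serves the row sums of the transport matrix; with \<open>f\<close> the identity
  it partitions the domain.\<close>

lemma measure_vimage_Ico_partition:
  fixes t :: "nat \<Rightarrow> real" and f :: "real \<Rightarrow> real"
  assumes "\<And>a b. B \<inter> f -` {a..<b} \<in> fmeasurable lborel" "\<And>k. k < n \<Longrightarrow> t k \<le> t (Suc k)"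
  shows "measure lborel (B \<inter> f -` {t 0..<t n}) =
    (\<Sum>k<n. measure lborel (B \<inter> f -` {t k..<t (Suc k)}))"
  using assms(2)
proof (induction n)
  case (Suc n)
  have "t 0 \<le> t k" if "k \<le> n" for k
    using that Suc.prems by (induction k) (auto intro: order_trans)
  then have "t 0 \<le> t n" "t n \<le> t (Suc n)" using Suc.prems by auto
  then have "B \<inter> f -` {t 0..<t (Suc n)} = (B \<inter> f -` {t 0..<t n}) \<union> (B \<inter> f -` {t n..<t (Suc n)})" by auto
  moreover have "emeasure lborel (B \<inter> f -` {a..<b}) \<noteq> \<infinity>" for a b
    using fmeasurableD2[OF assms(1)] by simp
  ultimately have "measure lborel (B \<inter> f -` {t 0..<t (Suc n)}) =
      measure lborel (B \<inter> f -` {t 0..<t n}) + measure lborel (B \<inter> f -` {t n..<t (Suc n)})"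
    using fmeasurableD[OF assms(1)] by (simp, subst measure_Union) auto
  then show ?case using Suc by simp
qed simp

lemma fmeasurable_bounded:
  assumes "B \<in> sets borel" "bounded B"
  shows "B \<in> fmeasurable lborel"
  using assms emeasure_bounded_finite by (auto simp: fmeasurable_def)

lemma measure_Ico_partition:
  fixes t :: "nat \<Rightarrow> real"
  assumes "B \<in> sets borel" "\<And>k. k < n \<Longrightarrow> t k \<le> t (Suc k)"
  shows "measure lborel (B \<inter> {t 0..<t n}) = (\<Sum>k<n. measure lborel (B \<inter> {t k..<t (Suc k)}))"
proof -
  have "B \<inter> (\<lambda>x. x) -` {a..<b} \<in> fmeasurable lborel" for a b :: real
    using assms(1) by (intro fmeasurable_bounded)
      (auto intro: bounded_subset[OF bounded_closed_interval[of a b]])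
  from measure_vimage_Ico_partition[where f = "\<lambda>x. x" and t = t, OF this assms(2)]
  show ?thesis by (simp add: vimage_def)
qed

text \<open>The derivative relative to \<open>{p..r}\<close> is unique even at an endpoint. Hence,
  where \<open>g\<close> is differentiable at a breakpoint, the slopes of both neighbouring pieces
  must agree.\<close>

lemma affine_piece_derivative:
  fixes g :: "real \<Rightarrow> real"
  assumes "p < r" "x \<in> {p..r}" "\<And>y. y \<in> {p..r} \<Longrightarrow> g y = c * y + d"
    and "(g has_real_derivative D) (at x)"
  shows "D = c"
proof -
  have "((\<lambda>y. c * y + d) has_real_derivative c) (at x within {p..r})"
    by (auto intro!: derivative_eq_intros)
  then have "(g has_real_derivative c) (at x within {p..r})"
    by (rule has_field_derivative_transform_within[where d = 1]) (use assms in auto)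
  moreover have "(g has_real_derivative D) (at x within {p..r})"
    using assms(4) by (rule has_field_derivative_at_within)
  moreover have "at x within {p..r} \<noteq> bot"
    using assms(1,2) by (simp add: trivial_limit_within)
  ultimately show ?thesis using has_field_derivative_unique by blast
qed

section \<open>Polygonal graphs on a dyadic grid\<close>

text \<open>The points \<open>(t k, h k / 2 ^ m)\<close> are the vertices of a polygonal graph.
  \<open>level\<close> makes the time spent in a cell equal to its length, which yields measure
  preservation; \<open>mq\<close> forces steep slopes; \<open>growth\<close> says that the pieces
  lying over cells of \<open>T\<close> cover more cells than \<open>T\<close> has, which drives the
  covering argument.\<close>

locale zigzag =
  fixes m q L :: nat and t :: "nat \<Rightarrow> real" and h :: "nat \<Rightarrow> nat"
  assumes t_0: "t 0 = 0" and t_L: "t L = 1"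
    and step: "\<And>k. k < L \<Longrightarrow> t (Suc k) - t k \<in> {1 / 2 ^ q, 1 / 2 ^ q / 2}"
    and adj: "\<And>k. k < L \<Longrightarrow> h (Suc k) = Suc (h k) \<or> h k = Suc (h (Suc k))"
    and h_le: "\<And>k. k \<le> L \<Longrightarrow> h k \<le> 2 ^ m"
    and mq: "m + 2 \<le> q"
    and level: "\<And>j. j < 2 ^ m \<Longrightarrow>
      (\<Sum>k<L. if min (h k) (h (Suc k)) = j then t (Suc k) - t k else 0) = 1 / 2 ^ m"
    and growth: "\<And>T :: nat set. T \<subseteq> {..<2 ^ m} \<Longrightarrow> T \<noteq> {} \<Longrightarrow> T \<noteq> {..<2 ^ m} \<Longrightarrow>
      card T < card {min (h k) (h (Suc k)) |k. k < L \<and>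
        (\<exists>j\<in>T. real j / 2 ^ m \<le> t k \<and> t (Suc k) \<le> (real j + 1) / 2 ^ m)}"
begin

definition lev :: "nat \<Rightarrow> nat" where
  "lev k = min (h k) (h (Suc k))"

definition cell :: "nat \<Rightarrow> real set" where
  "cell j = {j / 2 ^ m..(j + 1) / 2 ^ m}"

definition slope :: "nat \<Rightarrow> real" where
  "slope k = (real (h (Suc k)) - real (h k)) / (2 ^ m * (t (Suc k) - t k))"

text \<open>A sum of clamped ramps, one per piece, is continuous on the whole line and needs no
  choice of a piece; \<open>val_piece\<close> recovers the affine form.\<close>

definition val :: "real \<Rightarrow> real" where
  "val x = (h 0 + (\<Sum>k<L. (real (h (Suc k)) - real (h k)) *
     max 0 (min 1 ((x - t k) / (t (Suc k) - t k))))) / 2 ^ m"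

definition g :: "real \<Rightarrow> real" where
  "g = restrict val {0..1}"

lemma step_pos: "k < L \<Longrightarrow> t k < t (Suc k)"
  using step[of k] by (metis diff_gt_0_iff_gt divide_pos_pos empty_iff insert_iff zero_less_numeral zero_less_one zero_less_power)

lemma t_mono: "i \<le> j \<Longrightarrow> j \<le> L \<Longrightarrow> t i \<le> t j"
proof (induction j rule: dec_induct)
  case (step n)
  then show ?case using step_pos[of n] by simp
qed simp

lemma t_bounds: "k \<le> L \<Longrightarrow> 0 \<le> t k" "k \<le> L \<Longrightarrow> t k \<le> 1"
  using t_mono[of 0 k] t_mono[of k L] t_0 t_L by auto

text \<open>Together with \<open>left_piece\<close> this provides the pieces adjacent to an interior
  point on its right and on its left; at a breakpoint the two differ.\<close>

lemma right_piece:
  assumes "0 \<le> x" "x < 1"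
  obtains k where "k < L" "t k \<le> x" "x < t (Suc k)"
proof -
  have "\<exists>k<n. t k \<le> x \<and> x < t (Suc k)" if "x < t n" for n
    using that
  proof (induction n)
    case (Suc n)
    then show ?case by (cases "x < t n") (auto intro: less_SucI)
  qed (use assms t_0 in auto)
  from this[of L] show ?thesis using that assms t_L by auto
qed

lemma left_piece:
  assumes "0 < x" "x \<le> 1"
  obtains k where "k < L" "t k < x" "x \<le> t (Suc k)"
proof -
  have "\<exists>k<n. t k < x \<and> x \<le> t (Suc k)" if "x \<le> t n" for n
    using that
  proof (induction n)
    case (Suc n)
    then show ?case by (cases "x \<le> t n") (auto intro: less_SucI)
  qed (use assms t_0 in auto)
  from this[of L] show ?thesis using that assms t_L by auto
qed

lemma piece:
  assumes "x \<in> {0..1}"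
  obtains k where "k < L" "x \<in> {t k..t (Suc k)}"
proof (cases "x = 1")
  case True
  then obtain k where "k < L" "t k < x" "x \<le> t (Suc k)" using left_piece[of x] by auto
  then show ?thesis using that by auto
next
  case False
  then obtain k where "k < L" "t k \<le> x" "x < t (Suc k)" using assms right_piece[of x] by auto
  then show ?thesis using that by auto
qed

text \<open>On piece \<open>k\<close> the earlier ramps have saturated at 1 and their increments
  telescope to \<open>h k - h 0\<close>, while the later ramps are still 0.\<close>

lemma val_piece:
  assumes k: "k < L" and x: "x \<in> {t k..t (Suc k)}"
  shows "val x = h k / 2 ^ m + slope k * (x - t k)"
proof -
  let ?f = "\<lambda>l. (real (h (Suc l)) - real (h l)) * max 0 (min 1 ((x - t l) / (t (Suc l) - t l)))"
  have "(\<Sum>l<L. ?f l) = (\<Sum>l<Suc k. ?f l)"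
  proof (rule sum.mono_neutral_right)
    show "\<forall>l\<in>{..<L} - {..<Suc k}. ?f l = 0"
    proof
      fix l assume l: "l \<in> {..<L} - {..<Suc k}"
      then have "t (Suc k) \<le> t l" by (intro t_mono) auto
      then have "(x - t l) / (t (Suc l) - t l) \<le> 0"
        using x l step_pos[of l] by (intro divide_nonpos_pos) auto
      then show "?f l = 0" by simp
    qed
  qed (use k in auto)
  also have "\<dots> = (\<Sum>l<k. ?f l) + ?f k" by simp
  also have "(\<Sum>l<k. ?f l) = (\<Sum>l<k. real (h (Suc l)) - real (h l))"
  proof (rule sum.cong)
    fix l assume l: "l \<in> {..<k}"
    then have "t (Suc l) \<le> t k" using k by (intro t_mono) auto
    then have "1 \<le> (x - t l) / (t (Suc l) - t l)"
      using x l k step_pos[of l] by (simp add: le_divide_eq)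
    then show "?f l = real (h (Suc l)) - real (h l)" by simp
  qed simp
  also have "\<dots> = real (h k) - real (h 0)" by (rule sum_lessThan_telescope)
  also have "?f k = (real (h (Suc k)) - real (h k)) * ((x - t k) / (t (Suc k) - t k))"
  proof -
    have "0 \<le> (x - t k) / (t (Suc k) - t k)" "(x - t k) / (t (Suc k) - t k) \<le> 1"
      using x step_pos[OF k] by (simp_all add: divide_le_eq)
    then show ?thesis by simp
  qed
  finally show ?thesis
    by (simp add: val_def slope_def add_divide_distrib)
qed

lemma val_Suc: "k < L \<Longrightarrow> val (t (Suc k)) = h (Suc k) / 2 ^ m"
  using val_piece[of k "t (Suc k)"] step_pos[of k]
  by (simp add: slope_def add_divide_distrib[symmetric])

lemma val_t: "k < L \<Longrightarrow> val (t k) = h k / 2 ^ m"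
  using val_piece[of k "t k"] step_pos[of k] by simp

lemma lev_less: "k < L \<Longrightarrow> lev k < 2 ^ m"
  using adj[of k] h_le[of k] h_le[of "Suc k"] by (auto simp: lev_def)

lemma val_piece_cell:
  assumes k: "k < L" and x: "x \<in> {t k..t (Suc k)}"
  shows "val x \<in> cell (lev k)"
proof -
  let ?D = "t (Suc k) - t k"
  define s where "s = (x - t k) / ?D"
  have D: "0 < ?D" using step_pos[OF k] by simp
  have s: "0 \<le> s" "s \<le> 1" using D x by (auto simp: s_def divide_le_eq)
  have "slope k * (x - t k) = (real (h (Suc k)) - real (h k)) * s / 2 ^ m"
    by (simp add: slope_def s_def)
  then have "val x = (h k + (real (h (Suc k)) - real (h k)) * s) / 2 ^ m"
    using val_piece[OF assms] by (simp add: add_divide_distrib)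
  then show ?thesis
    using adj[OF k] s by (auto simp: cell_def lev_def divide_right_mono)
qed

lemma abs_slope:
  assumes "k < L"
  shows "\<bar>slope k\<bar> = 1 / (2 ^ m * (t (Suc k) - t k))"
  using adj[OF assms] step_pos[OF assms] by (auto simp: slope_def abs_mult)

lemma slope_nonzero: "k < L \<Longrightarrow> slope k \<noteq> 0"
  using abs_slope[of k] step_pos[of k] by auto

text \<open>A piece rises or falls by \<open>1 / 2 ^ m\<close> within a time of at most
  \<open>1 / 2 ^ q\<close>, and \<open>q\<close> is at least \<open>m + 2\<close>.\<close>

lemma slope_ge:
  assumes "k < L"
  shows "4 \<le> \<bar>slope k\<bar>"
proof -
  have "t (Suc k) - t k \<le> 1 / 2 ^ q" using step[OF assms] by (auto simp: field_simps)
  then have "2 ^ (m + 2) * (t (Suc k) - t k) \<le> 2 ^ (m + 2) * (1 / 2 ^ q)"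
    by (intro mult_left_mono) auto
  also have "\<dots> \<le> 1"
    using power_increasing[OF mq, of "2::real"] by (simp add: divide_le_eq)
  finally have "4 * (2 ^ m * (t (Suc k) - t k)) \<le> 1" by (simp add: power_add mult.assoc)
  then show ?thesis
    using step_pos[OF assms] by (simp add: abs_slope[OF assms] le_divide_eq)
qed

lemma slope_power:
  assumes "k < L"
  shows "\<exists>z s. s \<in> {1, -1} \<and> slope k = s * 2 powi z"
proof -
  have "\<bar>slope k\<bar> = 2 powi (int q - int m) \<or> \<bar>slope k\<bar> = 2 powi (int q + 1 - int m)"
    using step[OF assms] by (auto simp: abs_slope[OF assms] power_int_diff power_int_add)
  then obtain z where "\<bar>slope k\<bar> = 2 powi z" by blast
  then have "slope k = 1 * 2 powi z \<or> slope k = -1 * 2 powi z" by linarith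
  then show ?thesis by blast
qed

lemma continuous_val: "continuous_on S val"
proof -
  have "continuous_on S (\<lambda>x. max 0 (min 1 ((x - t k) / (t (Suc k) - t k))))" if "k < L" for k
    using step_pos[OF that] by (intro continuous_intros) auto
  then show ?thesis
    unfolding val_def by (intro continuous_on_divide continuous_on_add continuous_on_sum
        continuous_on_mult continuous_on_const) auto
qed

lemma val_bounds:
  assumes "x \<in> {0..1}"
  shows "val x \<in> {0..1}"
proof -
  obtain k where k: "k < L" "x \<in> {t k..t (Suc k)}" using piece[OF assms] .
  then have "lev k + 1 \<le> 2 ^ m" using lev_less by (simp add: Suc_leI)
  then have "(real (lev k) + 1) / 2 ^ m \<le> 1"
    by (simp add: divide_le_eq) (metis add.commute of_nat_Suc of_nat_le_iff of_nat_numeral of_nat_power)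
  moreover have "0 \<le> real (lev k) / 2 ^ m" by simp
  moreover have "real (lev k) / 2 ^ m \<le> val x" "val x \<le> (real (lev k) + 1) / 2 ^ m"
    using val_piece_cell[OF k] by (auto simp: cell_def)
  ultimately show ?thesis unfolding atLeastAtMost_iff by linarith
qed

lemma g_eq: "x \<in> {0..1} \<Longrightarrow> g x = val x"
  by (simp add: g_def)

lemma piece_subset: "k < L \<Longrightarrow> {t k..t (Suc k)} \<subseteq> {0..1}"
  using t_bounds[of k] t_bounds[of "Suc k"] by auto

lemma g_piece:
  assumes k: "k < L" and x: "x \<in> {t k..t (Suc k)}"
  shows "g x = slope k * x + (h k / 2 ^ m - slope k * t k)"
proof -
  have "x \<in> {0..1}" using piece_subset[OF k] x by blast
  then show ?thesis
    using val_piece[OF assms] by (simp add: g_eq algebra_simps)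
qed

lemma continuous_g: "continuous_on {0..1} g"
  using continuous_val g_eq continuous_on_cong by blast

lemma g_range: "x \<in> {0..1} \<Longrightarrow> g x \<in> {0..1}"
  using val_bounds g_eq by simp

lemma g_Icc:
  assumes "0 \<le> x" "x \<le> y" "y \<le> 1"
  shows "{min (g x) (g y)..max (g x) (g y)} \<subseteq> g ` {x..y}"
proof -
  have "connected (g ` {x..y})"
    using assms by (intro connected_continuous_image continuous_on_subset[OF continuous_g]) auto
  then show ?thesis
    using assms connected_contains_Icc[of "g ` {x..y}"] by (auto simp: min_def max_def)
qed

lemma cell_subset_image:
  assumes "k < L"
  shows "cell (lev k) \<subseteq> g ` {t k..t (Suc k)}"
proof -
  have "g (t k) = h k / 2 ^ m" "g (t (Suc k)) = h (Suc k) / 2 ^ m"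
    using assms val_t val_Suc t_bounds[of k] t_bounds[of "Suc k"] by (auto simp: g_eq)
  then have "cell (lev k) = {min (g (t k)) (g (t (Suc k)))..max (g (t k)) (g (t (Suc k)))}"
    using adj[OF assms] by (auto simp: cell_def lev_def min_def max_def divide_le_cancel add.commute)
  then show ?thesis
    using g_Icc[of "t k" "t (Suc k)"] step_pos[OF assms] t_bounds[of k] t_bounds[of "Suc k"] assms by auto
qed

section \<open>Preservation of Lebesgue measure\<close>

lemma Union_cells: "(\<Union>j<2 ^ m. cell j) = {0..1}"
proof
  show "(\<Union>j<2 ^ m. cell j) \<subseteq> {0..1}"
  proof clarify
    fix j x assume j_less: "j < (2::nat) ^ m" and "x \<in> cell j"
    then have j: "real j / 2 ^ m \<le> x" "x \<le> (real j + 1) / 2 ^ m" by (auto simp: cell_def)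
    have "real j + 1 \<le> 2 ^ m"
      using j_less by (metis Suc_leI add.commute of_nat_Suc of_nat_le_iff of_nat_numeral of_nat_power)
    then have "(real j + 1) / 2 ^ m \<le> 1" by simp
    moreover have "0 \<le> real j / 2 ^ m" by simp
    ultimately show "x \<in> {0..1}" using j unfolding atLeastAtMost_iff by linarith
  qed
  show "{0..1} \<subseteq> (\<Union>j<2 ^ m. cell j)"
  proof
    fix x :: real assume x: "x \<in> {0..1}"
    show "x \<in> (\<Union>j<2 ^ m. cell j)"
    proof (cases "x = 1")
      case True
      have "real (2 ^ m - 1) = 2 ^ m - 1" by (simp add: of_nat_diff)
      then have "x \<in> cell (2 ^ m - 1)" using True by (auto simp: cell_def field_simps)
      then show ?thesis by auto
    next
      case False
      define j where "j = nat \<lfloor>x * 2 ^ m\<rfloor>"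
      have j: "real j = of_int \<lfloor>x * 2 ^ m\<rfloor>" using x by (simp add: j_def)
      have "real j \<le> x * 2 ^ m" "x * 2 ^ m < real j + 1" unfolding j by linarith+
      moreover have "x * 2 ^ m < 2 ^ m" using x False by simp
      ultimately have "real j < 2 ^ m" by linarith
      moreover have "x \<in> cell j"
        using \<open>real j \<le> x * 2 ^ m\<close> \<open>x * 2 ^ m < real j + 1\<close> by (auto simp: cell_def field_simps)
      moreover from \<open>real j < 2 ^ m\<close> have "j < 2 ^ m"
        by (metis of_nat_less_iff of_nat_numeral of_nat_power)
      ultimately show ?thesis by auto
    qed
  qed
qed

lemma measure_cells:
  assumes "A \<in> sets borel" "A \<subseteq> {0..1}"
  shows "measure lborel A = (\<Sum>j<2 ^ m. measure lborel (A \<inter> cell j))"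
proof -
  have "measure lborel (A \<inter> {0/2^m..<(2^m)/2^m}) =
      (\<Sum>j<2 ^ m. measure lborel (A \<inter> {real j / 2 ^ m..<real (Suc j) / 2 ^ m}))"
    using measure_Ico_partition[OF assms(1), of "2 ^ m" "\<lambda>j. real j / 2 ^ m"]
    by (simp add: divide_right_mono)
  moreover have "A \<inter> {0..1} = A" using assms by auto
  ultimately show ?thesis
    using assms by (simp add: measure_Int_Ico cell_def add.commute)
qed

text \<open>Each piece maps affinely onto its cell, so preimages scale by the reciprocal of the
  absolute slope.\<close>

lemma measure_piece_preimage:
  assumes A: "A \<in> sets borel" and k: "k < L"
  shows "measure lborel (val -` A \<inter> {t k..t (Suc k)}) =
    2 ^ m * (t (Suc k) - t k) * measure lborel (A \<inter> cell (lev k))"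
proof -
  let ?r = "1 / slope k" and ?d = "t k - h k / 2 ^ m / slope k"
  have sl: "slope k \<noteq> 0" using slope_nonzero[OF k] .
  have im: "val -` A \<inter> {t k..t (Suc k)} = (\<lambda>y. ?r *\<^sub>R y + ?d) ` (A \<inter> cell (lev k))"
  proof (intro equalityI subsetI)
    fix x assume x: "x \<in> val -` A \<inter> {t k..t (Suc k)}"
    then have "x = ?r *\<^sub>R val x + ?d"
      using val_piece[OF k, of x] sl by (simp add: field_simps)
    then show "x \<in> (\<lambda>y. ?r *\<^sub>R y + ?d) ` (A \<inter> cell (lev k))"
      using x val_piece_cell[OF k, of x] by blast
  next
    fix x assume "x \<in> (\<lambda>y. ?r *\<^sub>R y + ?d) ` (A \<inter> cell (lev k))"
    then obtain y where y: "x = ?r * y + ?d" "y \<in> A" "y \<in> cell (lev k)" by auto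
    obtain x' where x': "x' \<in> {t k..t (Suc k)}" "y = g x'"
      using y(3) cell_subset_image[OF k] by auto
    then have "y = slope k * x' + (h k / 2 ^ m - slope k * t k)" using g_piece[OF k] by simp
    then have "x' = x" using y(1) sl by (simp add: field_simps)
    then show "x \<in> val -` A \<inter> {t k..t (Suc k)}"
      using x' y piece_subset[OF k] g_eq by (metis IntI subsetD vimageI)
  qed
  have bA: "A \<inter> cell (lev k) \<in> sets borel" using A by (auto simp: cell_def)
  have bV: "val -` A \<inter> {t k..t (Suc k)} \<in> sets borel"
    using A borel_measurable_continuous_onI[OF continuous_val] measurable_sets[of val borel borel A]
    by auto
  have "measure lborel (val -` A \<inter> {t k..t (Suc k)}) = measure lebesgue (val -` A \<inter> {t k..t (Suc k)})"
    using bV by (simp add: measure_completion)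
  also have "\<dots> = \<bar>?r\<bar> * measure lebesgue (A \<inter> cell (lev k))"
    unfolding im by (subst measure_lebesgue_affine) simp
  also have "\<dots> = \<bar>?r\<bar> * measure lborel (A \<inter> cell (lev k))"
    using bA by (simp add: measure_completion)
  also have "\<bar>?r\<bar> = 2 ^ m * (t (Suc k) - t k)"
    using abs_slope[OF k] by simp
  finally show ?thesis .
qed

lemma lambda_preserving_g: "lambda_preserving g"
  unfolding lambda_preserving_def
proof (intro ballI impI)
  fix A :: "real set" assume A: "A \<in> sets borel" "A \<subseteq> {0..1}"
  have vA: "val -` A \<in> sets borel"
    using A borel_measurable_continuous_onI[OF continuous_val] measurable_sets[of val borel borel A]
    by auto
  have "measure lborel (val -` A \<inter> {0..1}) = measure lborel (val -` A \<inter> {t 0..<t L})"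
    using measure_Int_Ico[OF vA] t_0 t_L by simp
  also have "\<dots> = (\<Sum>k<L. measure lborel (val -` A \<inter> {t k..<t (Suc k)}))"
    using vA step_pos by (intro measure_Ico_partition) (auto intro: less_imp_le)
  also have "\<dots> = (\<Sum>k<L. 2 ^ m * (t (Suc k) - t k) * measure lborel (A \<inter> cell (lev k)))"
    using measure_Int_Ico[OF vA] measure_piece_preimage[OF A(1)] by (intro sum.cong) auto
  \<comment> \<open>Regroup the pieces by the cell they cross; by \<open>level\<close> the durations
    for one cell add up to \<open>1 / 2 ^ m\<close>, which cancels the factor
    \<open>2 ^ m\<close>.\<close>
  also have "\<dots> = (\<Sum>k<L. \<Sum>j<2 ^ m. if lev k = j then 2 ^ m * (t (Suc k) - t k) * measure lborel (A \<inter> cell j) else 0)"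
    using lev_less by (intro sum.cong) auto
  also have "\<dots> = (\<Sum>j<2 ^ m. \<Sum>k<L. if lev k = j then 2 ^ m * (t (Suc k) - t k) * measure lborel (A \<inter> cell j) else 0)"
    by (rule sum.swap)
  also have "\<dots> = (\<Sum>j<2 ^ m. 2 ^ m * measure lborel (A \<inter> cell j) * (\<Sum>k<L. if lev k = j then t (Suc k) - t k else 0))"
    unfolding sum_distrib_left by (intro sum.cong) auto
  also have "\<dots> = (\<Sum>j<2 ^ m. measure lborel (A \<inter> cell j))"
    using level by (intro sum.cong) (auto simp: lev_def)
  also have "\<dots> = measure lborel A" using measure_cells[OF A] by simp
  finally have eq: "measure lborel (val -` A \<inter> {0..1}) = measure lborel A" .
  have "g -` A \<inter> {0..1} = val -` A \<inter> {0..1}" by (auto simp: g_def)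
  moreover have "emeasure lborel B = ennreal (measure lborel B)" if "B \<subseteq> {0..1}" for B :: "real set"
  proof -
    have "bounded B" using that by (rule bounded_subset[OF bounded_closed_interval])
    then show ?thesis using emeasure_bounded_finite by (intro emeasure_eq_ennreal_measure) fastforce
  qed
  ultimately show "emeasure lborel A = emeasure lborel (g -` A \<inter> {0..1})"
    using eq A(2) by simp
qed

section \<open>Derivatives and breakpoints\<close>

lemma deriv_interior:
  assumes k: "k < L" and x: "t k < x" "x < t (Suc k)"
  shows "(g has_real_derivative slope k) (at x)"
proof -
  have "((\<lambda>y. slope k * y + (h k / 2 ^ m - slope k * t k)) has_real_derivative slope k) (at x)"
    by (auto intro!: derivative_eq_intros)
  then show ?thesis
    by (rule has_field_derivative_transform_within_open[where S = "{t k<..<t (Suc k)}"])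
       (use x g_piece[OF k] in auto)
qed

lemma deriv_eq_slope:
  assumes "k < L" "x \<in> {t k..t (Suc k)}" "(g has_real_derivative D) (at x)"
  shows "D = slope k"
  using affine_piece_derivative[OF step_pos[OF assms(1)] assms(2) g_piece[OF assms(1)] assms(3)] .

lemma nondiff_points_subset: "nondiff_points g \<subseteq> t ` {..L}"
proof
  fix x assume x: "x \<in> nondiff_points g"
  then obtain k where k: "k < L" "x \<in> {t k..t (Suc k)}"
    using piece by (auto simp: nondiff_points_def)
  have "\<not> (t k < x \<and> x < t (Suc k))"
  proof
    assume "t k < x \<and> x < t (Suc k)"
    then have "g differentiable (at x within {0..1})"
      using deriv_interior[OF k(1)] by (meson differentiable_at_withinI real_differentiable_def)
    then show False using x by (simp add: nondiff_points_def)
  qed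
  then have "x = t k \<or> x = t (Suc k)" using k by auto
  then show "x \<in> t ` {..L}" using k by auto
qed

lemma t_dyadic: "k \<le> L \<Longrightarrow> t k \<in> dyadic_numbers"
proof -
  assume "k \<le> L"
  \<comment> \<open>The exponent is \<open>Suc q\<close> because of the half steps.\<close>
  then have "\<exists>z::int. t k = z / 2 ^ Suc q"
  proof (induction k)
    case 0
    then show ?case using t_0 by (intro exI[of _ 0]) simp
  next
    case (Suc k)
    then obtain z :: int where z: "t k = z / 2 ^ Suc q" by auto
    have "t (Suc k) = of_int (z + 2) / 2 ^ Suc q \<or> t (Suc k) = of_int (z + 1) / 2 ^ Suc q"
      using step[of k] Suc.prems z by (auto simp: add_divide_distrib)
    then show ?case by blast
  qed
  then show ?thesis unfolding dyadic_numbers_def by blast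
qed

text \<open>The interval may contain breakpoints at which neighbouring slopes agree. At every point
  the derivative equals the slope of the piece on each side, so it is locally constant and hence
  constant on the connected interval.\<close>

lemma deriv_constant:
  assumes ab: "0 \<le> a" "a < b" "b \<le> 1" and diff: "\<forall>x\<in>{a<..<b}. g differentiable (at x)"
  shows "\<exists>(k :: int) s. s \<in> {1, -1} \<and> (\<forall>x\<in>{a<..<b}. (g has_real_derivative s * 2 powi k) (at x))"
proof -
  have D: "(g has_real_derivative deriv g x) (at x)" if "x \<in> {a<..<b}" for x
    using diff that by (meson DERIV_deriv_iff_real_differentiable)
  have "deriv g x = deriv g y" if xy: "x \<in> {a<..<b}" "y \<in> {a<..<b}" for x y
  proof (rule connected_local_const[OF _ xy])
    show "\<forall>x\<in>{a<..<b}. eventually (\<lambda>y. deriv g x = deriv g y) (at x within {a<..<b})"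
    proof
      fix x assume x: "x \<in> {a<..<b}"
      have "0 < x" "x < 1" using x ab by auto
      obtain k where k: "k < L" "t k \<le> x" "x < t (Suc k)"
        using right_piece[of x] \<open>0 < x\<close> \<open>x < 1\<close> by auto
      obtain l where l: "l < L" "t l < x" "x \<le> t (Suc l)"
        using left_piece[of x] \<open>0 < x\<close> \<open>x < 1\<close> by auto
      have eq: "slope k = deriv g x" "slope l = deriv g x"
        using deriv_eq_slope[OF k(1) _ D[OF x]] deriv_eq_slope[OF l(1) _ D[OF x]] k l by auto
      have "deriv g x = deriv g y" if "y \<in> {t l<..<t (Suc k)}" "y \<in> {a<..<b}" for y
      proof (cases "y \<le> x")
        case True
        then show ?thesis using deriv_eq_slope[OF l(1) _ D[OF that(2)]] that l eq by auto
      next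
        case False
        then show ?thesis using deriv_eq_slope[OF k(1) _ D[OF that(2)]] that k eq by auto
      qed
      moreover have "eventually (\<lambda>y. y \<in> {t l<..<t (Suc k)}) (nhds x)"
        using k l by (intro eventually_nhds_in_open) auto
      ultimately show "eventually (\<lambda>y. deriv g x = deriv g y) (at x within {a<..<b})"
        unfolding eventually_at_filter by (auto elim: eventually_mono)
    qed
  qed auto
  moreover have c: "(a + b) / 2 \<in> {a<..<b}" using ab by auto
  moreover obtain k where k: "k < L" "(a + b) / 2 \<in> {t k..t (Suc k)}"
    using piece[of "(a + b) / 2"] ab by auto
  ultimately have "deriv g x = slope k" if "x \<in> {a<..<b}" for x
    using deriv_eq_slope[OF k D[OF c]] that by metis
  then show ?thesis using slope_power[OF k(1)] D by metis
qed

lemma g_PiE: "g \<in> {0..1} \<rightarrow>\<^sub>E {0..1}"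
  using val_bounds by (auto simp: g_def)

section \<open>Expansion and covering under iteration\<close>

lemma g_funpow_range: "x \<in> {0..1} \<Longrightarrow> (g ^^ n) x \<in> {0..1}"
  by (induction n) (use g_range in auto)

lemma expand_in_piece:
  assumes "k < L" "t k \<le> x" "x \<le> y" "y \<le> t (Suc k)"
  shows "\<exists>x' y'. 0 \<le> x' \<and> y' \<le> 1 \<and> 4 * (y - x) \<le> y' - x' \<and> {x'..y'} \<subseteq> g ` {x..y}"
proof -
  have xy: "x \<in> {t k..t (Suc k)}" "y \<in> {t k..t (Suc k)}" using assms by auto
  have xy01: "x \<in> {0..1}" "y \<in> {0..1}" using xy piece_subset[OF assms(1)] by blast+
  have "g y - g x = slope k * (y - x)"
    using g_piece[OF assms(1) xy(1)] g_piece[OF assms(1) xy(2)] by (simp add: algebra_simps)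
  then have "4 * (y - x) \<le> \<bar>g y - g x\<bar>"
    using mult_right_mono[OF slope_ge[OF assms(1)], of "y - x"] assms by (simp add: abs_mult)
  also have "\<bar>g y - g x\<bar> = max (g x) (g y) - min (g x) (g y)" by auto
  finally show ?thesis
    using g_Icc[of x y] assms xy01 g_range[OF xy01(1)] g_range[OF xy01(2)]
    by (intro exI[of _ "min (g x) (g y)"] exI[of _ "max (g x) (g y)"]) auto
qed

text \<open>An interval containing no full piece meets at most two pieces, so at least half of it
  lies in one piece; there it is stretched by 4, hence by 2 relative to the whole interval.\<close>

lemma expand:
  assumes "0 \<le> x" "x < y" "y \<le> 1"
  shows "(\<exists>k<L. {t k..t (Suc k)} \<subseteq> {x..y}) \<or>
    (\<exists>x' y'. 0 \<le> x' \<and> y' \<le> 1 \<and> 2 * (y - x) \<le> y' - x' \<and> {x'..y'} \<subseteq> g ` {x..y})"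
proof -
  obtain k where k: "k < L" "t k \<le> x" "x < t (Suc k)"
    using right_piece[of x] assms by auto
  obtain l where l: "l < L" "t l < y" "y \<le> t (Suc l)"
    using left_piece[of y] assms by auto
  have halves: ?thesis
    if H: "2 * (y - x) \<le> 4 * (y' - x')" "i < L" "t i \<le> x'" "x' \<le> y'" "y' \<le> t (Suc i)"
      "{x'..y'} \<subseteq> {x..y}" for i x' y'
  proof -
    obtain a b where "0 \<le> a" "b \<le> 1" "4 * (y' - x') \<le> b - a" "{a..b} \<subseteq> g ` {x'..y'}"
      using expand_in_piece[OF H(2-5)] by blast
    moreover have "g ` {x'..y'} \<subseteq> g ` {x..y}" using H(6) by blast
    ultimately have "0 \<le> a \<and> b \<le> 1 \<and> 2 * (y - x) \<le> b - a \<and> {a..b} \<subseteq> g ` {x..y}"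
      using H(1) by auto
    then show ?thesis by blast
  qed
  consider "y \<le> t (Suc k)" | "Suc k \<le> l" "t (Suc k) < y" "t l > t (Suc k)" | "t (Suc k) < y" "t l = t (Suc k)"
  proof -
    have "Suc k \<le> l" if "t (Suc k) < y"
    proof (rule ccontr)
      assume "\<not> Suc k \<le> l"
      then have "t (Suc l) \<le> t (Suc k)" using k by (intro t_mono) auto
      then show False using that l by simp
    qed
    then show ?thesis using that t_mono[of "Suc k" l] l by fastforce
  qed
  then show ?thesis
  proof cases
    case 1
    then show ?thesis using halves[of y x k] k assms by auto
  next
    case 2
    then have "Suc k < L" using l by simp
    have "Suc k < l" using 2 by (metis le_neq_implies_less less_irrefl)
    then have "t (Suc (Suc k)) \<le> t l" using l by (intro t_mono) auto
    then have "{t (Suc k)..t (Suc (Suc k))} \<subseteq> {x..y}" using k l by auto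
    then show ?thesis using \<open>Suc k < L\<close> by blast
  next
    case 3
    show ?thesis
    proof (cases "y - x \<le> 2 * (t (Suc k) - x)")
      case True
      then show ?thesis using halves[of "t (Suc k)" x k] k 3 by auto
    next
      case False
      then show ?thesis using halves[of y "t l" l] k l 3 by auto
    qed
  qed
qed

text \<open>As long as no full piece is covered, the length of an interval inside the image at least
  doubles with each iterate, which is impossible within \<open>{0..1}\<close>.\<close>

lemma reaches_piece:
  assumes "0 \<le> x" "x < y" "y \<le> 1" "{x..y} \<subseteq> U"
  shows "\<exists>n k. k < L \<and> {t k..t (Suc k)} \<subseteq> (g ^^ n) ` U"
proof (rule ccontr)
  assume no: "\<not> ?thesis"
  have "\<exists>x' y'. 0 \<le> x' \<and> y' \<le> 1 \<and> 2 ^ n * (y - x) \<le> y' - x' \<and> {x'..y'} \<subseteq> (g ^^ n) ` U" for n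
  proof (induction n)
    case 0
    show ?case using assms by (intro exI[of _ x] exI[of _ y]) auto
  next
    case (Suc n)
    then obtain x' y' where n: "0 \<le> x'" "y' \<le> 1" "2 ^ n * (y - x) \<le> y' - x'" "{x'..y'} \<subseteq> (g ^^ n) ` U"
      by blast
    have "0 < 2 ^ n * (y - x)" using assms by simp
    then have "x' < y'" using n(3) by linarith
    moreover have "\<not> (\<exists>k<L. {t k..t (Suc k)} \<subseteq> {x'..y'})" using no n(4) by blast
    ultimately obtain a b where ab: "0 \<le> a" "b \<le> 1" "2 * (y' - x') \<le> b - a" "{a..b} \<subseteq> g ` {x'..y'}"
      using expand[of x' y'] n by auto
    have "g ` {x'..y'} \<subseteq> (g ^^ Suc n) ` U" using n(4) by (auto simp: image_comp[symmetric])
    then have "0 \<le> a \<and> b \<le> 1 \<and> 2 ^ Suc n * (y - x) \<le> b - a \<and> {a..b} \<subseteq> (g ^^ Suc n) ` U"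
      using ab n(3) by auto
    then show ?case by blast
  qed
  moreover obtain n where "1 / (y - x) < 2 ^ n" using real_arch_pow[of 2 "1 / (y - x)"] by auto
  ultimately show False
    using assms by (auto simp: divide_less_eq) (smt (verit, best))
qed

lemma LEO_g: "LEO g"
  unfolding LEO_def
proof (intro allI impI, elim conjE)
  fix U :: "real set" assume U: "openin (top_of_set {0..1}) U" "U \<noteq> {}"
  have U01: "U \<subseteq> {0..1}" using U(1) openin_imp_subset by blast
  obtain z where z: "z \<in> U" using U by auto
  obtain e where e: "0 < e" "\<And>x. x \<in> {0..1} \<Longrightarrow> dist x z < e \<Longrightarrow> x \<in> U"
    using U(1) z unfolding openin_euclidean_subtopology_iff by blast
  define x y where "x = max 0 (z - e / 2)" and "y = min 1 (z + e / 2)"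
  have "z \<in> {0..1}" using z U01 by blast
  then have "0 \<le> x" "x < y" "y \<le> 1" using e by (auto simp: x_def y_def)
  moreover have "{x..y} \<subseteq> U"
  proof
    fix w assume "w \<in> {x..y}"
    then show "w \<in> U" using e(1) by (intro e(2)) (auto simp: x_def y_def dist_real_def abs_le_iff)
  qed
  ultimately obtain n k where nk: "k < L" "{t k..t (Suc k)} \<subseteq> (g ^^ n) ` U"
    using reaches_piece by blast
  \<comment> \<open>Each iterate gains at least one cell; the cap \<open>2 ^ m\<close> lets the
    induction idle once all cells are covered.\<close>
  have grow: "\<exists>n T. T \<subseteq> {..<2 ^ m} \<and> min (Suc r) (2 ^ m) \<le> card T \<and> (\<Union>j\<in>T. cell j) \<subseteq> (g ^^ n) ` U" for r
  proof (induction r)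
    case 0
    have "cell (lev k) \<subseteq> (g ^^ Suc n) ` U"
      using cell_subset_image[OF nk(1)] nk(2) by (simp add: image_comp[symmetric]) blast
    then show ?case using lev_less[OF nk(1)]
      by (intro exI[of _ "Suc n"] exI[of _ "{lev k}"]) auto
  next
    case (Suc r)
    then obtain n T where T: "T \<subseteq> {..<2 ^ m}" "min (Suc r) (2 ^ m) \<le> card T"
      "(\<Union>j\<in>T. cell j) \<subseteq> (g ^^ n) ` U" by blast
    show ?case
    proof (cases "T = {..<2 ^ m}")
      case True
      then show ?thesis using T by (intro exI[of _ n] exI[of _ T]) auto
    next
      case False
      define T' where "T' = {min (h k) (h (Suc k)) |k. k < L \<and>
        (\<exists>j\<in>T. real j / 2 ^ m \<le> t k \<and> t (Suc k) \<le> (real j + 1) / 2 ^ m)}"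
      have "0 < min (Suc r) (2 ^ m)" by simp
      then have "T \<noteq> {}" using T(2) by (metis card.empty leD)
      then have "card T < card T'" using growth[OF T(1)] False unfolding T'_def by blast
      moreover have "T' \<subseteq> {..<2 ^ m}" using lev_less by (auto simp: T'_def lev_def)
      moreover have "(\<Union>j\<in>T'. cell j) \<subseteq> (g ^^ Suc n) ` U"
      proof -
        have "cell j' \<subseteq> (g ^^ Suc n) ` U" if j': "j' \<in> T'" for j'
        proof -
          obtain k j where kj: "j' = lev k" "k < L" "j \<in> T" "j / 2 ^ m \<le> t k" "t (Suc k) \<le> (j + 1) / 2 ^ m"
            using j' by (auto simp: T'_def lev_def)
          then have "{t k..t (Suc k)} \<subseteq> cell j" by (auto simp: cell_def)
          then have "{t k..t (Suc k)} \<subseteq> (g ^^ n) ` U" using T(3) kj by blast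
          then show ?thesis
            using cell_subset_image[OF kj(2)] kj(1) by (simp add: image_comp[symmetric]) blast
        qed
        then show ?thesis by blast
      qed
      ultimately show ?thesis using T(2) by (intro exI[of _ "Suc n"] exI[of _ T']) auto
    qed
  qed
  obtain n T where T: "T \<subseteq> {..<2 ^ m}" "2 ^ m \<le> card T" "(\<Union>j\<in>T. cell j) \<subseteq> (g ^^ n) ` U"
    using grow[of "2 ^ m"] by auto
  then have "T = {..<2 ^ m}"
    by (metis card_lessThan card_seteq finite_lessThan)
  then have "{0..1} \<subseteq> (g ^^ n) ` U" using T(3) Union_cells by simp
  moreover have "(g ^^ n) ` U \<subseteq> {0..1}" using U01 g_funpow_range by blast
  ultimately show "\<exists>N. (g ^^ N) ` U = {0..1}" by blast
qed

lemma g_onto: "g ` {0..1} = {0..1}"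
proof
  show "g ` {0..1} \<subseteq> {0..1}" using g_range by blast
  show "{0..1} \<subseteq> g ` {0..1}"
  proof -
    have "cell j \<subseteq> g ` {0..1}" if j: "j < 2 ^ m" for j
    proof -
      have "(\<Sum>k<L. if min (h k) (h (Suc k)) = j then t (Suc k) - t k else 0) \<noteq> 0"
        using level[OF j] by simp
      then obtain k where "k \<in> {..<L}" "(if min (h k) (h (Suc k)) = j then t (Suc k) - t k else 0) \<noteq> 0"
        using sum.not_neutral_contains_not_neutral by blast
      then have "k < L" "lev k = j" by (auto simp: lev_def split: if_splits)
      then show ?thesis using cell_subset_image[of k] piece_subset[of k] by blast
    qed
    then show ?thesis unfolding Union_cells[symmetric] by blast
  qed
qed

lemma piecewise_affine_g: "piecewise_affine g"
  unfolding piecewise_affine_def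
  using t_0 t_L step_pos g_piece by (intro exI[of _ L] exI[of _ t]) blast

lemma g_thompson: "g \<in> thompson_monoid_LEO"
proof -
  have "finite (nondiff_points g)" using nondiff_points_subset finite_surj by blast
  moreover have "nondiff_points g \<subseteq> dyadic_numbers"
    using nondiff_points_subset t_dyadic by blast
  ultimately show ?thesis
    unfolding thompson_monoid_LEO_def thompson_monoid_def
    using g_PiE continuous_g g_onto lambda_preserving_g piecewise_affine_g deriv_constant LEO_g
    by blast
qed

end

subsection \<open>Transport matrices\<close>

lemma C_lambda_vimage:
  assumes "f \<in> C_lambda" "A \<in> sets borel"
  shows "f -` A \<inter> {0..1} \<in> sets borel"
proof -
  have "f \<in> borel_measurable (restrict_space borel {0..1})"
    using assms(1) by (intro borel_measurable_continuous_on_restrict) (simp add: C_lambda_def)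
  from measurable_sets[OF this assms(2)] show ?thesis
    by (simp add: space_restrict_space sets_restrict_space_iff)
qed

lemma C_lambda_measure:
  assumes "f \<in> C_lambda" "A \<in> sets borel" "A \<subseteq> {0..1}"
  shows "measure lborel (f -` A \<inter> {0..1}) = measure lborel A"
  using assms by (auto simp: C_lambda_def lambda_preserving_def measure_def)

lemma C_lambda_matrix:
  fixes M N :: nat
  assumes f: "f \<in> C_lambda" and "0 < M" "0 < N"
  defines "a \<equiv> \<lambda>i j. measure lborel ({real i / N..<(real i + 1) / N} \<inter>
    (f -` {real j / M..<(real j + 1) / M} \<inter> {0..1}))"
  shows "\<And>i. i < N \<Longrightarrow> (\<Sum>j<M. a i j) = 1 / N"
    and "\<And>j. j < M \<Longrightarrow> (\<Sum>i<N. a i j) = 1 / M"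
proof -
  have sub: "{real j / K..<(real j + 1) / K} \<subseteq> {0..1}" if "j < K" for j K :: nat
  proof -
    have "real j + 1 \<le> real K" using that by simp
    then have "(real j + 1) / K \<le> 1" using that by (simp add: divide_le_eq)
    moreover have "0 \<le> real j / K" by simp
    ultimately show ?thesis unfolding subset_iff atLeastLessThan_iff atLeastAtMost_iff by linarith
  qed
  have len: "measure lborel {real j / K..<(real j + 1) / K} = 1 / K" for j K :: nat
    by (simp add: measure_lborel_Ico divide_right_mono diff_divide_distrib[symmetric])
  show "(\<Sum>j<M. a i j) = 1 / N" if i: "i < N" for i
  proof -
    let ?I = "{real i / N..<(real i + 1) / N}"
    have "?I \<inter> f -` {u..<v} \<in> fmeasurable lborel" for u v :: real
    proof (rule fmeasurable_bounded)
      have "?I \<inter> f -` {u..<v} = ?I \<inter> (f -` {u..<v} \<inter> {0..1})" using sub[OF i] by blast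
      then show "?I \<inter> f -` {u..<v} \<in> sets borel"
        using C_lambda_vimage[OF f, of "{u..<v}"] by simp
    qed (use bounded_closed_interval sub[OF i] in \<open>blast intro: bounded_subset\<close>)
    then have "measure lborel (?I \<inter> f -` {real 0 / M..<real M / M}) =
      (\<Sum>j<M. measure lborel (?I \<inter> f -` {real j / M..<real (Suc j) / M}))"
      by (rule measure_vimage_Ico_partition) (simp add: divide_right_mono)
    also have "\<dots> = (\<Sum>j<M. a i j)"
      unfolding a_def using sub[OF i]
      by (intro sum.cong refl arg_cong[where f = "measure lborel"]) (auto simp: add.commute)
    finally have 1: "(\<Sum>j<M. a i j) = measure lborel (?I \<inter> f -` {0..<1})" using \<open>0 < M\<close> by simp
    \<comment> \<open>The half-open cells miss the value 1, but the fibre over 1 is null because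
      \<open>f\<close> preserves measure.\<close>
    have "emeasure lborel (f -` {1} \<inter> {0..1}) = emeasure lborel {1::real}"
    proof -
      have "lambda_preserving f" using f by (simp add: C_lambda_def)
      then show ?thesis unfolding lambda_preserving_def by (elim ballE[of _ _ "{1}"]) auto
    qed
    then have null: "f -` {1} \<inter> {0..1} \<in> null_sets lborel"
      using C_lambda_vimage[OF f, of "{1}"] by (simp add: null_sets_def)
    have "measure lborel (?I \<inter> f -` {0..<1}) = measure lborel ?I"
    proof (rule measure_eq_AE)
      show "AE x in lborel. (x \<in> ?I \<inter> f -` {0..<1}) = (x \<in> ?I)"
        using AE_not_in[OF null]
      proof eventually_elim
        case (elim x)
        have "f x \<in> {0..1}" if "x \<in> {0..1}" using f that by (auto simp: C_lambda_def PiE_iff)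
        then show ?case using elim sub[OF i] by (cases "x \<in> ?I") (auto simp: less_le)
      qed
      have "?I \<inter> f -` {0..<1} = ?I \<inter> (f -` {0..<1} \<inter> {0..1})" using sub[OF i] by blast
      then show "?I \<inter> f -` {0..<1} \<in> sets lborel"
        using C_lambda_vimage[OF f, of "{0..<1}"] by simp
    qed simp
    then show ?thesis using 1 len by simp
  qed
  show "(\<Sum>i<N. a i j) = 1 / M" if j: "j < M" for j
  proof -
    let ?B = "f -` {real j / M..<(real j + 1) / M} \<inter> {0..1}"
    have B: "?B \<in> sets borel" by (rule C_lambda_vimage[OF f]) simp
    have "measure lborel (?B \<inter> {real 0 / N..<real N / N}) =
      (\<Sum>i<N. measure lborel (?B \<inter> {real i / N..<real (Suc i) / N}))"
      by (rule measure_Ico_partition[OF B]) (simp add: divide_right_mono)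
    also have "\<dots> = (\<Sum>i<N. a i j)"
      unfolding a_def by (intro sum.cong refl) (simp add: Int_commute add.commute)
    finally have "(\<Sum>i<N. a i j) = measure lborel (?B \<inter> {0..1})"
      using measure_Int_Ico[OF B] \<open>0 < N\<close> by simp
    also have "\<dots> = 1 / M" using C_lambda_measure[OF f _ sub[OF j]] len by simp
    finally show ?thesis .
  qed
qed

section \<open>Rounding to a dyadic matrix\<close>

text \<open>Flooring the cumulative row sums keeps the row sums and leaves an error \<open>E j\<close> at each column
  boundary. It is moved into a row \<open>r j\<close> with both adjacent entries positive, so the support is
  unaffected.\<close>

lemma dyadic_rounding:
  fixes m n p M N :: nat and b :: "nat \<Rightarrow> nat \<Rightarrow> real"
  assumes M: "M = 2 ^ m" and N: "N = 2 ^ n"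
    and nonneg: "\<And>i j. 0 \<le> b i j"
    and row: "\<And>i. i < N \<Longrightarrow> (\<Sum>j<M. b i j) = 1 / N"
    and col: "\<And>j. j < M \<Longrightarrow> (\<Sum>i<N. b i j) = 1 / M"
    and link: "\<And>j. Suc j < M \<Longrightarrow> \<exists>i<N. 0 < b i j \<and> 0 < b i (Suc j)"
  obtains q and c :: "nat \<Rightarrow> nat \<Rightarrow> nat" where "p \<le> q"
    "\<forall>i<N. (\<Sum>j<M. c i j) * (1 / 2 ^ q) = 1 / N"
    "\<forall>j<M. (\<Sum>i<N. c i j) * (1 / 2 ^ q) = 1 / M"
    "\<forall>i<N. \<forall>j<M. if b i j = 0 then c i j = 0 else 2 \<le> c i j"
proof -
  have MN: "0 < M" "0 < N" by (auto simp: M N)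
  \<comment> \<open>The element 1 keeps \<open>Z\<close> nonempty; its minimum is a positive lower
    bound for all positive entries.\<close>
  define Z where "Z = insert 1 {x \<in> case_prod b ` ({..<N} \<times> {..<M}). 0 < x}"
  define \<beta> where "\<beta> = Min Z"
  have Z: "finite Z" "Z \<noteq> {}" by (auto simp: Z_def)
  have \<beta>: "0 < \<beta>" using Min_in[OF Z] by (auto simp: \<beta>_def Z_def)
  have \<beta>_le: "\<beta> \<le> b i j" if "i < N" "j < M" "b i j \<noteq> 0" for i j
    unfolding \<beta>_def using Z(1)
  proof (rule Min_le)
    show "b i j \<in> Z" using that nonneg[of i j] by (force simp: Z_def)
  qed
  \<comment> \<open>A boundary correction can lower an increment by up to \<open>N\<close>, and 2
    must remain; scaled positive entries of at least \<open>N + 4\<close> allow for both.\<close>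
  obtain q1 where q1: "(real N + 4) / \<beta> < 2 ^ q1"
    using real_arch_pow[of 2 "(real N + 4) / \<beta>"] by auto
  \<comment> \<open>The summands \<open>m\<close> and \<open>n\<close> make \<open>Q / M\<close> and
    \<open>Q / N\<close> integers; \<open>p\<close> is the requested lower bound.\<close>
  define q where "q = p + q1 + m + n"
  define Q :: real where "Q = 2 ^ q"
  have "(2::real) ^ q1 \<le> Q" unfolding Q_def q_def by (intro power_increasing) auto
  then have Q\<beta>: "real N + 4 \<le> Q * \<beta>" using q1 \<beta> by (simp add: divide_less_eq) (smt (verit) mult_right_mono)
  have "0 < Q" by (simp add: Q_def)
  have QM: "Q = 2 ^ (q - m) * real M" and QN: "Q = 2 ^ (q - n) * real N"
    by (simp_all add: Q_def M N q_def power_add[symmetric])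
  define B where "B = (\<lambda>i j. \<Sum>k<j. b i k)"
  define F0 where "F0 = (\<lambda>i j. \<lfloor>Q * B i j\<rfloor>)"
  define E where "E = (\<lambda>j. 2 ^ (q - m) * int j - (\<Sum>i<N. F0 i j))"
  \<comment> \<open>At the outer boundaries 0 and \<open>M\<close> the condition is vacuous and any
    row serves, the correction there being 0 by \<open>E_0\<close> and \<open>E_M\<close>.\<close>
  have "\<exists>i<N. 0 < j \<longrightarrow> j < M \<longrightarrow> 0 < b i (j - 1) \<and> 0 < b i j" for j
    using link[of "j - 1"] MN by (cases j) auto
  then obtain r where r: "\<And>j. r j < N" "\<And>j. 0 < j \<Longrightarrow> j < M \<Longrightarrow> 0 < b (r j) (j - 1) \<and> 0 < b (r j) j"
    by metis
  define F where "F = (\<lambda>i j. F0 i j + (if i = r j then E j else 0))"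
  have sumB: "(\<Sum>i<N. Q * B i j) = 2 ^ (q - m) * real j" if "j \<le> M" for j
  proof -
    have "(\<Sum>i<N. B i j) = (\<Sum>k<j. \<Sum>i<N. b i k)"
      unfolding B_def by (rule sum.swap)
    also have "\<dots> = (\<Sum>k<j. 1 / real M)" using that col by (intro sum.cong) auto
    finally show ?thesis using MN by (simp add: sum_distrib_left[symmetric] QM)
  qed
  have E_bounds: "0 \<le> E j \<and> E j \<le> int N" if "j \<le> M" for j
  proof -
    have "(\<Sum>i<N. real_of_int (F0 i j)) \<le> (\<Sum>i<N. Q * B i j)"
      unfolding F0_def by (intro sum_mono) linarith
    moreover have "(\<Sum>i<N. Q * B i j) \<le> (\<Sum>i<N. real_of_int (F0 i j) + 1)"
      unfolding F0_def by (intro sum_mono) linarith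
    moreover have "real_of_int (E j) = (\<Sum>i<N. Q * B i j) - (\<Sum>i<N. real_of_int (F0 i j))"
      using sumB[OF that] by (simp add: E_def)
    ultimately have "0 \<le> real_of_int (E j)" "real_of_int (E j) \<le> real N"
      by (simp_all add: sum.distrib)
    then show ?thesis by linarith
  qed
  have F0_0: "F0 i 0 = 0" for i by (simp add: F0_def B_def)
  have F0_M: "F0 i M = 2 ^ (q - n)" if "i < N" for i
  proof -
    have "Q * B i M = of_int (2 ^ (q - n))" using row[OF that] MN by (simp add: B_def QN)
    then show ?thesis unfolding F0_def by (metis floor_of_int)
  qed
  have E_0: "E 0 = 0" by (simp add: E_def F0_0)
  have E_M: "E M = 0"
  proof -
    have "2 ^ (q - m) * real M = 2 ^ (q - n) * real N" using QM QN by simp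
    then have "(2 ^ (q - m) * int M) = 2 ^ (q - n) * int N"
      by (metis (mono_tags) of_int_eq_iff of_int_mult of_int_numeral of_int_of_nat_eq of_int_power)
    then show ?thesis using F0_M by (simp add: E_def)
  qed
  \<comment> \<open>If \<open>i\<close> is the row corrected at boundary \<open>j\<close> or
    \<open>Suc j\<close>, a zero entry \<open>b i j\<close> forces that boundary to be 0 or
    \<open>M\<close>, where the correction is 0.\<close>
  have step0: "F i (Suc j) = F i j" if ij: "i < N" "j < M" "b i j = 0" for i j
  proof -
    have "E (Suc j) = 0" if "i = r (Suc j)"
      using r(2)[of "Suc j"] that ij E_M by (cases "Suc j = M") auto
    moreover have "E j = 0" if "i = r j"
      using r(2)[of j] that ij E_0 by (cases "j = 0") auto
    moreover have "F0 i (Suc j) = F0 i j" using ij by (simp add: F0_def B_def)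
    ultimately show ?thesis by (auto simp: F_def)
  qed
  have step2: "F i j + 2 \<le> F i (Suc j)" if ij: "i < N" "j < M" "b i j \<noteq> 0" for i j
  proof -
    have "real N + 4 \<le> Q * b i j"
      using Q\<beta> mult_left_mono[OF \<beta>_le[OF ij], of Q] \<open>0 < Q\<close> by linarith
    then have "F0 i j + int N + 2 \<le> F0 i (Suc j)"
      unfolding F0_def B_def by (simp add: distrib_left) linarith
    then show ?thesis using E_bounds[of j] E_bounds[of "Suc j"] ij by (auto simp: F_def)
  qed
  define c where "c = (\<lambda>i j. nat (F i (Suc j) - F i j))"
  have c: "int (c i j) = F i (Suc j) - F i j" if "i < N" "j < M" for i j
    using step0[OF that] step2[OF that] by (cases "b i j = 0") (auto simp: c_def)
  have rowF: "(\<Sum>j<M. int (c i j)) = 2 ^ (q - n)" if "i < N" for i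
  proof -
    have "(\<Sum>j<M. int (c i j)) = (\<Sum>j<M. F i (Suc j) - F i j)" using c that by simp
    also have "\<dots> = F i M - F i 0" by (rule sum_lessThan_telescope)
    finally show ?thesis using F0_M[OF that] by (simp add: F_def E_0 E_M F0_0)
  qed
  have sumF: "(\<Sum>i<N. F i j) = 2 ^ (q - m) * int j" for j
    using r(1)[of j] by (simp add: F_def E_def sum.distrib)
  have colF: "(\<Sum>i<N. int (c i j)) = 2 ^ (q - m)" if "j < M" for j
  proof -
    have "(\<Sum>i<N. int (c i j)) = (\<Sum>i<N. F i (Suc j)) - (\<Sum>i<N. F i j)"
      using c that by (simp add: sum_subtractf)
    then show ?thesis unfolding sumF by (simp add: distrib_left)
  qed
  have "real (\<Sum>j<M. c i j) * (1 / 2 ^ q) = 1 / N" if "i < N" for i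
  proof -
    have "real (\<Sum>j<M. c i j) = 2 ^ (q - n)"
      using arg_cong[OF rowF[OF that], of real_of_int] by simp
    then show ?thesis using QN MN unfolding Q_def by (simp add: field_simps)
  qed
  moreover have "real (\<Sum>i<N. c i j) * (1 / 2 ^ q) = 1 / M" if "j < M" for j
  proof -
    have "real (\<Sum>i<N. c i j) = 2 ^ (q - m)"
      using arg_cong[OF colF[OF that], of real_of_int] by simp
    then show ?thesis using QM MN unfolding Q_def by (simp add: field_simps)
  qed
  moreover have "if b i j = 0 then c i j = 0 else 2 \<le> c i j" if "i < N" "j < M" for i j
    using step0[OF that] step2[OF that] by (auto simp: c_def)
  moreover have "p \<le> q" by (simp add: q_def)
  ultimately show ?thesis using that[of q c] by blast
qed

section \<open>Spreading mass to neighbouring cells\<close>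

text \<open>Truncated subtraction (\<open>0 - 1 = 0\<close>) and the minimum reflect the mass at the two ends.\<close>

definition mix :: "nat \<Rightarrow> (nat \<Rightarrow> real) \<Rightarrow> nat \<Rightarrow> real" where
  "mix M x j = (x (j - 1) + 2 * x j + x (min (Suc j) (M - 1))) / 4"

text \<open>The two reflected shifts together count each entry twice: one repeats \<open>x 0\<close>
  and drops the last entry, the other does the reverse.\<close>

lemma sum_mix:
  assumes "0 < M"
  shows "(\<Sum>j<M. mix M x j) = (\<Sum>j<M. x j)"
proof -
  obtain K where K: "M = Suc K" using assms by (cases M) auto
  have "(\<Sum>j<M. x (j - 1)) = x 0 + (\<Sum>j<K. x j)"
    unfolding K sum.lessThan_Suc_shift by simp
  moreover have "(\<Sum>j<M. x (min (Suc j) (M - 1))) = (\<Sum>j<K. x (Suc j)) + x K"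
    unfolding K by (simp add: min_def)
  moreover have "(\<Sum>j<M. x j) = (\<Sum>j<K. x j) + x K" "(\<Sum>j<M. x j) = x 0 + (\<Sum>j<K. x (Suc j))"
    unfolding K by (simp, rule sum.lessThan_Suc_shift)
  ultimately show ?thesis
    by (simp add: mix_def sum_divide_distrib[symmetric] sum.distrib sum_distrib_left[symmetric])
qed

lemma mix_pos_iff:
  assumes "\<And>j. 0 \<le> x j"
  shows "0 < mix M x j \<longleftrightarrow> 0 < x (j - 1) \<or> 0 < x j \<or> 0 < x (min (Suc j) (M - 1))"
  using assms[of "j - 1"] assms[of j] assms[of "min (Suc j) (M - 1)"] by (auto simp: mix_def)

text \<open>The two possible supports \<open>{s}\<close> and \<open>{s, s + 1}\<close> both become a
  block of consecutive columns, clipped at 0 and \<open>M\<close>. Such a block is what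
  \<open>reach_tour\<close> can traverse.\<close>

lemma mix_support:
  assumes "\<And>j. 0 \<le> x j" "s < M" "0 < x s" "\<And>j. j < M \<Longrightarrow> 0 < x j \<Longrightarrow> j = s \<or> j = Suc s" "j < M"
  shows "0 < mix M x j \<longleftrightarrow>
    s - 1 \<le> j \<and> j < (if Suc s < M \<and> 0 < x (Suc s) then min M (s + 3) else min M (s + 2))"
proof -
  define p where "p \<longleftrightarrow> 0 < x (Suc s)"
  have *: "0 < x k \<longleftrightarrow> k = s \<or> k = Suc s \<and> p" if "k < M" for k
    using assms(3) assms(4)[OF that] by (auto simp: p_def)
  have lt: "j - 1 < M" "min (Suc j) (M - 1) < M" using assms(5) by auto
  show ?thesis
    unfolding mix_pos_iff[OF assms(1)] p_def[symmetric] *[OF lt(1)] *[OF assms(5)]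
      *[OF lt(2)]
    using assms(2,5) unfolding min_def by (cases p; cases j; cases s; auto)
qed

text \<open>If every neighbour of \<open>R\<close> belonged to \<open>R\<close>, walking up and down
  from one element would fill \<open>{..<M}\<close>. At the ends the clipped neighbour is the cell
  itself, as in \<open>mix\<close>.\<close>

lemma exists_boundary:
  fixes R :: "nat set"
  assumes "R \<subseteq> {..<M}" "R \<noteq> {}" "R \<noteq> {..<M}"
  shows "\<exists>j<M. j \<notin> R \<and> (j - 1 \<in> R \<or> min (Suc j) (M - 1) \<in> R)"
proof (rule ccontr)
  assume no: "\<not> ?thesis"
  obtain r where r: "r \<in> R" using assms by auto
  have "r + k < M \<longrightarrow> r + k \<in> R" for k
  proof (induction k)
    case (Suc k)
    then show ?case using no by (auto dest!: spec[of _ "Suc (r + k)"])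
  qed (use r in auto)
  moreover have "r - k \<in> R" for k
  proof (induction k)
    case (Suc k)
    have "min (Suc (r - Suc k)) (M - 1) = r - k" if "0 < r - k"
      using Suc assms(1) that by auto
    moreover have "r - Suc k < M" using r assms(1) by auto
    ultimately show ?case using no Suc by (cases "r - k") (auto dest!: spec[of _ "r - Suc k"])
  qed (use r in auto)
  ultimately have "j \<in> R" if "j < M" for j
    using that by (metis diff_diff_cancel le_add_diff_inverse nat_le_linear)
  then show False using assms by auto
qed

section \<open>From a transport matrix to a polygonal map\<close>

text \<open>\<open>near\<close> encodes continuity: within a row or across two consecutive rows,
  positive entries lie in columns at most 1 apart, the other inequality following by exchanging the
  roles.\<close>

locale transport =
  fixes m n :: nat and M N :: nat and a :: "nat \<Rightarrow> nat \<Rightarrow> real"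
  assumes M: "M = 2 ^ m" and N: "N = 2 ^ n" and mn: "m + 2 \<le> n"
    and nonneg: "\<And>i j. 0 \<le> a i j"
    and row: "\<And>i. i < N \<Longrightarrow> (\<Sum>j<M. a i j) = 1 / N"
    and col: "\<And>j. j < M \<Longrightarrow> (\<Sum>i<N. a i j) = 1 / M"
    and near: "\<And>i i' j j'. \<lbrakk>i < N; i' < N; i \<le> Suc i'; i' \<le> Suc i; j < M; j' < M;
      0 < a i j; 0 < a i' j'\<rbrakk> \<Longrightarrow> j \<le> Suc j'"
begin

definition b :: "nat \<Rightarrow> nat \<Rightarrow> real" where
  "b i = mix M (a i)"

definition base :: "nat \<Rightarrow> nat" where
  "base i = (LEAST j. j < M \<and> 0 < a i j)"

text \<open>The exclusive upper end of the block of positive entries of \<open>b i\<close>, in the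
  form delivered by \<open>mix_support\<close>; as a height it is the top of that block.\<close>

definition hi :: "nat \<Rightarrow> nat" where
  "hi i = (if Suc (base i) < M \<and> 0 < a i (Suc (base i)) then min M (base i + 3) else min M (base i + 2))"

lemma MN_pos: "0 < M" "0 < N"
  by (auto simp: M N)

lemma base:
  assumes "i < N"
  shows "base i < M" "0 < a i (base i)"
proof -
  have "(\<Sum>j<M. a i j) \<noteq> 0" using row[OF assms] MN_pos by simp
  then obtain j where "j < M" "a i j \<noteq> 0"
    using sum.not_neutral_contains_not_neutral by blast
  then have "j < M \<and> 0 < a i j" using nonneg[of i j] by auto
  then have "base i < M \<and> 0 < a i (base i)" unfolding base_def by (rule LeastI)
  then show "base i < M" "0 < a i (base i)" by auto
qed

lemma base_cases:
  assumes "i < N" "j < M" "0 < a i j"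
  shows "j = base i \<or> j = Suc (base i)"
proof -
  have "base i \<le> j" unfolding base_def by (rule Least_le) (use assms in blast)
  moreover have "j \<le> Suc (base i)"
    using near[OF assms(1,1) _ _ assms(2) base(1)[OF assms(1)] assms(3) base(2)[OF assms(1)]] by simp
  ultimately show ?thesis by linarith
qed

lemma b_pos_iff:
  assumes "i < N" "j < M"
  shows "0 < b i j \<longleftrightarrow> base i - 1 \<le> j \<and> j < hi i"
  unfolding b_def hi_def
  using nonneg base[OF assms(1)] base_cases[OF assms(1)] assms(2) by (intro mix_support) auto

lemma b_nonneg: "0 \<le> b i j"
  by (simp add: b_def mix_def nonneg)

lemma row_b: "i < N \<Longrightarrow> (\<Sum>j<M. b i j) = 1 / N"
  using row sum_mix[OF MN_pos(1)] by (simp add: b_def)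

lemma col_b:
  assumes "j < M"
  shows "(\<Sum>i<N. b i j) = 1 / M"
proof -
  have "(\<Sum>i<N. b i j) =
    ((\<Sum>i<N. a i (j - 1)) + 2 * (\<Sum>i<N. a i j) + (\<Sum>i<N. a i (min (Suc j) (M - 1)))) / 4"
    by (simp add: b_def mix_def sum_divide_distrib[symmetric] sum.distrib sum_distrib_left[symmetric])
  then show ?thesis using assms col by (simp add: less_imp_diff_less)
qed

text \<open>Mass of \<open>a\<close> in column \<open>j\<close> partly stays there and partly moves
  to column \<open>Suc j\<close> of the same row. Such a row can absorb the rounding error of the
  boundary between the two columns.\<close>

lemma link:
  assumes "Suc j < M"
  shows "\<exists>i<N. 0 < b i j \<and> 0 < b i (Suc j)"
proof -
  have "(\<Sum>i<N. a i j) \<noteq> 0" using col[of j] assms MN_pos by simp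
  then obtain i where "i < N" "a i j \<noteq> 0"
    using sum.not_neutral_contains_not_neutral by blast
  then have "0 < a i j" using nonneg[of i j] by auto
  then have "0 < b i j" "0 < b i (Suc j)"
    unfolding b_def by (auto simp: mix_pos_iff nonneg)
  then show ?thesis using \<open>i < N\<close> by blast
qed

text \<open>The starting height of the next row lies within the height range of the current one, so
  the walk of row \<open>i\<close> can end where that of row \<open>Suc i\<close> starts.\<close>

lemma base_Suc:
  assumes "Suc i < N"
  shows "base i - 1 \<le> base (Suc i)" "base (Suc i) \<le> hi i"
  using near[of i "Suc i" "base i" "base (Suc i)"] near[of "Suc i" i "base (Suc i)" "base i"]
    base[of i] base[of "Suc i"] assms by (auto simp: hi_def)

lemma base_le_hi: "i < N \<Longrightarrow> base i \<le> hi i"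
  using base[of i] by (auto simp: hi_def)

text \<open>The cells hit by \<open>T\<close> under \<open>a\<close> carry at least the mass of \<open>T\<close>, so there are at least as many of
  them; passing from \<open>a\<close> to \<open>b\<close> adds a neighbour.\<close>

lemma spread:
  assumes T: "T \<subseteq> {..<M}" "T \<noteq> {}" "T \<noteq> {..<M}"
  shows "card T < card {j. j < M \<and> (\<exists>i<N. i div 2 ^ (n - m) \<in> T \<and> 0 < b i j)}"
proof -
  \<comment> \<open>Each cell of the domain consists of \<open>w\<close> consecutive rows, row
    \<open>i\<close> lying in cell \<open>i div w\<close>.\<close>
  define w :: nat where "w = 2 ^ (n - m)"
  define rows where "rows = {i. i < N \<and> i div w \<in> T}"
  define R where "R = {j. j < M \<and> (\<exists>i\<in>rows. 0 < a i j)}"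
  define R' where "R' = {j. j < M \<and> (\<exists>i\<in>rows. 0 < b i j)}"
  have w: "0 < w" "N = M * w"
    using mn by (simp_all add: w_def M N power_add[symmetric])
  have fin: "finite rows" "finite R" "finite R'" by (auto simp: rows_def R_def R'_def)
  have "card (T \<times> {..<w}) \<le> card rows"
  proof (rule card_inj_on_le[where f = "\<lambda>(t, r). t * w + r"])
    show "inj_on (\<lambda>(t, r). t * w + r) (T \<times> {..<w})"
      by (rule inj_on_inverseI[where g = "\<lambda>x. (x div w, x mod w)"]) auto
    have "t * w + r \<in> rows" if t: "t \<in> T" and r: "r < w" for t r
    proof -
      have "t * w + r < Suc t * w" using r by simp
      also have "\<dots> \<le> N" using t T(1) w by (intro order_trans[OF mult_le_mono1[of "Suc t" M]]) auto
      finally show ?thesis using t r by (simp add: rows_def)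
    qed
    then show "(\<lambda>(t, r). t * w + r) ` (T \<times> {..<w}) \<subseteq> rows" by auto
  qed (rule fin)
  then have rows: "card T * w \<le> card rows" by (simp add: card_cartesian_product)
  have "card rows / N = (\<Sum>i\<in>rows. \<Sum>j<M. a i j)"
    using row by (simp add: rows_def)
  also have "\<dots> = (\<Sum>i\<in>rows. \<Sum>j\<in>R. a i j)"
  proof (rule sum.cong[OF refl], rule sum.mono_neutral_right)
    fix i assume i: "i \<in> rows"
    show "\<forall>j\<in>{..<M} - R. a i j = 0"
    proof
      fix j assume "j \<in> {..<M} - R"
      then have "\<not> 0 < a i j" using i by (auto simp: R_def)
      then show "a i j = 0" using nonneg[of i j] by simp
    qed
  qed (auto simp: R_def)
  also have "\<dots> = (\<Sum>j\<in>R. \<Sum>i\<in>rows. a i j)" by (rule sum.swap)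
  also have "\<dots> \<le> (\<Sum>j\<in>R. \<Sum>i<N. a i j)"
    using nonneg by (intro sum_mono sum_mono2) (auto simp: rows_def)
  also have "\<dots> = card R / M" using col by (simp add: R_def)
  finally have "real (card rows) \<le> card R * w"
    using MN_pos w by (simp add: divide_le_eq)
  then have "card T * w \<le> card R * w"
    using rows by (metis of_nat_le_iff of_nat_mult order_trans)
  then have TR: "card T \<le> card R" using w by simp
  have "0 < card T" using T finite_subset[OF T(1)] by (simp add: card_gt_0_iff)
  then have "R \<noteq> {}" using TR by auto
  have sub: "R \<subseteq> R'" by (auto simp: R_def R'_def b_def mix_pos_iff nonneg)
  have "card T < card R'"
  \<comment> \<open>If all cells are already hit, strictness comes from \<open>T\<close> being
    proper; otherwise from a new neighbour.\<close>
  proof (cases "R = {..<M}")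
    case True
    have "card T < card {..<M}" using T by (intro psubset_card_mono) auto
    also have "\<dots> \<le> card R'" using sub True fin by (intro card_mono) auto
    finally show ?thesis .
  next
    case False
    obtain j where j: "j < M" "j \<notin> R" "j - 1 \<in> R \<or> min (Suc j) (M - 1) \<in> R"
      using exists_boundary[OF _ \<open>R \<noteq> {}\<close> False] by (auto simp: R_def)
    then have "j \<in> R'" by (auto simp: R_def R'_def b_def mix_pos_iff nonneg)
    then have "card R < card R'" using sub j fin by (intro psubset_card_mono) auto
    then show ?thesis using TR by simp
  qed
  moreover have "R' = {j. j < M \<and> (\<exists>i<N. i div 2 ^ (n - m) \<in> T \<and> 0 < b i j)}"
    by (auto simp: R'_def rows_def w_def)
  ultimately show ?thesis by simp
qed

text \<open>Row \<open>i\<close> of the rounded matrix prescribes a walk in time slot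
  \<open>i\<close>, starting at height \<open>base i\<close>; the concatenated walks give the
  vertices. The second conjunct keeps each piece near a cell that receives mass of \<open>a\<close>
  in its slot, for the comparison with the original map.\<close>

lemma exists_zigzag:
  "\<exists>q L t h. zigzag m q L t h \<and> (\<forall>k<L. \<exists>i<N. \<exists>s<M. 0 < a i s \<and>
     real i / N \<le> t k \<and> t (Suc k) \<le> (real i + 1) / N \<and>
     s \<le> Suc (min (h k) (h (Suc k))) \<and> min (h k) (h (Suc k)) \<le> s + 2)"
proof -
  obtain q and c :: "nat \<Rightarrow> nat \<Rightarrow> nat" where q: "m + 2 \<le> q"
    and c_row: "\<forall>i<N. (\<Sum>j<M. c i j) * (1 / 2 ^ q) = 1 / N"
    and c_col: "\<forall>j<M. (\<Sum>i<N. c i j) * (1 / 2 ^ q) = 1 / M"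
    and c: "\<forall>i<N. \<forall>j<M. if b i j = 0 then c i j = 0 else 2 \<le> c i j"
    using dyadic_rounding[where p = "m + 2", OF M N b_nonneg row_b col_b link] .
  define d :: real where "d = 1 / 2 ^ q"
  have d: "0 < d" by (simp add: d_def)
  \<comment> \<open>The rounding says nothing about columns from \<open>M\<close> on, so they are
    cut off.\<close>
  define c' where "c' i j = (if j < M then c i j else 0)" for i j
  have c'_pos: "0 < c' i j \<longleftrightarrow> j < M \<and> 0 < b i j" if "i < N" for i j
    using c[rule_format, OF that, of j] b_nonneg[of i j] by (auto simp: c'_def split: if_splits)
  \<comment> \<open>The walk of the last row returns to its own starting height.\<close>
  define u where "u i = (if i < N then base i else base (N - 1))" for i
  have reach: "reach d (c' i) (u i) (u (Suc i))" if i: "i < N" for i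
  proof (rule reach_tour)
    show "base i - 1 \<le> u i" "u i \<le> hi i" using i base_le_hi by (auto simp: u_def)
    have "u (Suc i) = base i" if "\<not> Suc i < N"
    proof -
      have "i = N - 1" using i that by linarith
      then show ?thesis using that by (simp add: u_def)
    qed
    then show "base i - 1 \<le> u (Suc i)" "u (Suc i) \<le> hi i"
      using base_Suc[of i] base_le_hi[OF i] by (cases "Suc i < N"; simp add: u_def)+
    have hi: "hi i \<le> M" by (auto simp: hi_def)
    show "2 \<le> c' i j" if "base i - 1 \<le> j" "j < hi i" for j
      using b_pos_iff[OF i, of j] c[rule_format, OF i, of j] that hi by (auto simp: c'_def split: if_splits)
    show "c' i j = 0" if "\<not> (base i - 1 \<le> j \<and> j < hi i)" for j
      using b_pos_iff[OF i, of j] c[rule_format, OF i, of j] b_nonneg[of i j] that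
      by (auto simp: c'_def less_le split: if_splits)
  qed
  have sum_c': "(\<Sum>j<M. c' i j) * d = 1 / real N" if "i < N" for i
    using c_row[rule_format, OF that] by (simp add: c'_def d_def)
  obtain es where es: "chain (0, u 0) es (N * (1 / real N), u N)" "\<forall>e\<in>set es. edge_ok d e"
    "\<forall>j. level_time j es = (\<Sum>i<N. c' i j * d)"
    "\<forall>e\<in>set es. \<exists>i<N. i * (1 / real N) \<le> fst (fst e) \<and> fst (snd e) \<le> Suc i * (1 / real N) \<and> 0 < c' i (edge_level e)"
    "\<forall>i<N. \<forall>j. 0 < c' i j \<longrightarrow> (\<exists>e\<in>set es. i * (1 / real N) \<le> fst (fst e) \<and> fst (snd e) \<le> Suc i * (1 / real N) \<and> edge_level e = j)"
    using reach_concat[where c = c' and u = u and w = "1 / real N" and k = N and M = M and N = N,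
        OF d reach _ sum_c' order_refl] by (auto simp: c'_def)
  define L where "L = length es"
  obtain P where P: "P 0 = (0, u 0)" "P L = (N * (1 / real N), u N)" "\<And>k. k < L \<Longrightarrow> es ! k = (P k, P (Suc k))"
    using chain_nth[OF es(1)] by (auto simp: L_def)
  define t where "t k = fst (P k)" for k
  define h where "h k = snd (P k)" for k
  define lev where "lev k = min (h k) (h (Suc k))" for k
  have mem: "(P k, P (Suc k)) \<in> set es" if "k < L" for k
    using P(3)[OF that] that nth_mem[of k es] by (simp add: L_def)
  have row_k: "\<exists>i<N. real i / N \<le> t k \<and> t (Suc k) \<le> (real i + 1) / N \<and> lev k < M \<and> 0 < b i (lev k)"
    if k: "k < L" for k
  proof -
    obtain i where "i < N" "i * (1 / real N) \<le> t k" "t (Suc k) \<le> Suc i * (1 / real N)" "0 < c' i (lev k)"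
      using bspec[OF es(4) mem[OF k]] by (auto simp: t_def h_def lev_def edge_level_def)
    then show ?thesis using c'_pos by (intro exI[of _ i]) (simp add: add.commute)
  qed
  have ok: "t (Suc k) - t k \<in> {d, d / 2}" "h (Suc k) = Suc (h k) \<or> h k = Suc (h (Suc k))" if "k < L" for k
    using es(2) mem[OF that] by (auto simp: edge_ok_def edge_dur_def adjacent_def t_def h_def)
  have t01: "t 0 = 0" "t L = 1" using P MN_pos by (auto simp: t_def)
  have L: "0 < L" using t01 by (metis gr0I zero_neq_one)
  have "zigzag m q L t h"
  proof
    show "t 0 = 0" "t L = 1" by (fact t01)+
    show "t (Suc k) - t k \<in> {1 / 2 ^ q, 1 / 2 ^ q / 2}" if "k < L" for k
      using ok(1)[OF that] by (simp add: d_def)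
    show "h (Suc k) = Suc (h k) \<or> h k = Suc (h (Suc k))" if "k < L" for k
      using ok(2)[OF that] .
    show "h k \<le> 2 ^ m" if "k \<le> L" for k
    proof -
      have both: "h l \<le> M" "h (Suc l) \<le> M" if "l < L" for l
        using row_k[OF that] ok(2)[OF that] by (auto simp: lev_def)
      show ?thesis
        using both(1)[of k] both(2)[of "L - 1"] that L M by (cases "k = L") auto
    qed
    show "m + 2 \<le> q" by (fact q)
    show "(\<Sum>k<L. if min (h k) (h (Suc k)) = j then t (Suc k) - t k else 0) = 1 / 2 ^ m"
      if "j < 2 ^ m" for j
    proof -
      have "level_time j es = (\<Sum>k<L. if min (h k) (h (Suc k)) = j then t (Suc k) - t k else 0)"
        unfolding level_time_def sum_list_sum_nth length_map L_def[symmetric] atLeast0LessThan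
        by (intro sum.cong refl) (simp add: L_def[symmetric] P(3) edge_level_def edge_dur_def t_def h_def)
      moreover have "level_time j es = 1 / M"
        using es(3) c_col[rule_format, of j] that by (simp add: c'_def d_def M sum_distrib_right sum_divide_distrib)
      ultimately show ?thesis by (simp add: M)
    qed
    show "card T < card {min (h k) (h (Suc k)) |k. k < L \<and>
        (\<exists>j\<in>T. real j / 2 ^ m \<le> t k \<and> t (Suc k) \<le> (real j + 1) / 2 ^ m)}"
      if T: "T \<subseteq> {..<2 ^ m}" "T \<noteq> {}" "T \<noteq> {..<2 ^ m}" for T
    proof -
      let ?T' = "{min (h k) (h (Suc k)) |k. k < L \<and>
        (\<exists>j\<in>T. real j / 2 ^ m \<le> t k \<and> t (Suc k) \<le> (real j + 1) / 2 ^ m)}"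
      let ?w = "(2::nat) ^ (n - m)"
      \<comment> \<open>A positive entry in a row over \<open>T\<close> yields an edge in the time
        slot of that row, and this slot lies inside a single domain cell from
        \<open>T\<close>.\<close>
      have "j \<in> ?T'" if H: "j < M" "i < N" "i div ?w \<in> T" "0 < b i j" for i j
      proof -
        have "0 < c' i j" using c'_pos H by simp
        then obtain e where e: "e \<in> set es" "i * (1 / real N) \<le> fst (fst e)"
          "fst (snd e) \<le> Suc i * (1 / real N)" "edge_level e = j"
          using es(5) H(2) by blast
        then obtain k where k: "k < L" "e = (P k, P (Suc k))"
          using P(3) by (metis L_def in_set_conv_nth)
        have NM: "real N = real M * real ?w"
          using mn by (simp add: M N power_add[symmetric])
        have le: "i div ?w * ?w \<le> i" "Suc i \<le> Suc (i div ?w) * ?w"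
          using dividend_less_div_times[of ?w i] by (auto simp: Suc_le_eq)
        have "real (i div ?w) * ?w \<le> real i" "real i + 1 \<le> (real (i div ?w) + 1) * ?w"
          using le[THEN of_nat_mono[where 'a = real]] by (auto simp: algebra_simps)
        then have "real (i div ?w) / M \<le> i / N" "(real i + 1) / N \<le> (real (i div ?w) + 1) / M"
          using divide_right_mono[of "real (i div ?w) * ?w" "real i" "real N"]
            divide_right_mono[of "real i + 1" "(real (i div ?w) + 1) * ?w" "real N"] MN_pos
          unfolding NM by simp_all
        then have "real (i div ?w) / 2 ^ m \<le> t k" "t (Suc k) \<le> (real (i div ?w) + 1) / 2 ^ m"
          using e(2,3) k(2) by (auto simp: t_def M add.commute)
        moreover have "j = min (h k) (h (Suc k))" using e(4) k(2) by (simp add: edge_level_def h_def)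
        ultimately show ?thesis using k(1) H(3) by blast
      qed
      then have "{j. j < M \<and> (\<exists>i<N. i div ?w \<in> T \<and> 0 < b i j)} \<subseteq> ?T'" by blast
      moreover have "finite ?T'" by simp
      ultimately have "card {j. j < M \<and> (\<exists>i<N. i div ?w \<in> T \<and> 0 < b i j)} \<le> card ?T'"
        by (rule card_mono[rotated])
      then show ?thesis using spread[of T] T by (simp add: M)
    qed
  qed
  moreover have "\<exists>i<N. \<exists>s<M. 0 < a i s \<and>
     real i / N \<le> t k \<and> t (Suc k) \<le> (real i + 1) / N \<and>
     s \<le> Suc (min (h k) (h (Suc k))) \<and> min (h k) (h (Suc k)) \<le> s + 2" if k: "k < L" for k
  proof -
    obtain i where i: "i < N" "real i / N \<le> t k" "t (Suc k) \<le> (real i + 1) / N" "lev k < M" "0 < b i (lev k)"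
      using row_k[OF k] by blast
    then have "base i - 1 \<le> lev k" "lev k < hi i" using b_pos_iff by auto
    then have "base i \<le> Suc (lev k)" "lev k \<le> base i + 2" by (auto simp: hi_def split: if_splits)
    then show ?thesis using i base[OF i(1)] unfolding lev_def by blast
  qed
  ultimately show ?thesis by blast
qed

end

section \<open>Uniform approximation and density\<close>

lemma thompson_LEO_approx:
  assumes f: "f \<in> C_lambda" and "0 < r"
  shows "\<exists>g\<in>thompson_monoid_LEO. \<forall>x\<in>{0..1}. \<bar>f x - g x\<bar> \<le> r"
proof -
  \<comment> \<open>The final error is at most \<open>4 / M\<close>: one cell width from moving
    \<open>x\<close> to a nearby \<open>y\<close>, and at most three between \<open>f y\<close> and
    \<open>g x\<close>.\<close>
  obtain m where m: "4 / r < 2 ^ m" using real_arch_pow[of 2 "4 / r"] by auto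
  define M :: nat where "M = 2 ^ m"
  have M: "0 < M" "real M = 2 ^ m" by (auto simp: M_def)
  have "uniformly_continuous_on {0..1} f"
    using f by (intro compact_uniformly_continuous) (auto simp: C_lambda_def)
  then obtain e where e: "0 < e" "\<And>x y. x \<in> {0..1} \<Longrightarrow> y \<in> {0..1} \<Longrightarrow> dist y x < e \<Longrightarrow> dist (f y) (f x) < 1 / M"
    unfolding uniformly_continuous_on_def using M by (metis of_nat_0_less_iff zero_less_divide_1_iff)
  \<comment> \<open>Points in the same or adjacent rows are at most \<open>2 / N\<close> apart, so
    \<open>3 / N < e\<close> brings them within the range of uniform continuity.\<close>
  obtain n0 where n0: "3 / e < 2 ^ n0" using real_arch_pow[of 2 "3 / e"] by auto
  define n where "n = n0 + m + 2"
  define N :: nat where "N = 2 ^ n"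
  have N: "0 < N" by (simp add: N_def)
  have "(2::real) ^ n0 \<le> 2 ^ n" unfolding n_def by (intro power_increasing) auto
  then have "3 / e < 2 ^ n" using n0 by linarith
  then have "3 / e < N" by (simp add: N_def)
  then have Ne: "3 / N < e" using e(1) N by (simp add: field_simps)
  define a where "a = (\<lambda>i j. measure lborel ({real i / N..<(real i + 1) / N} \<inter>
    (f -` {real j / M..<(real j + 1) / M} \<inter> {0..1})))"
  have a_pos: "\<exists>x\<in>{0..1}. real i / N \<le> x \<and> x \<le> (real i + 1) / N \<and> real j / M \<le> f x \<and> f x < (real j + 1) / M"
    if "0 < a i j" for i j
  proof -
    have "{real i / N..<(real i + 1) / N} \<inter> (f -` {real j / M..<(real j + 1) / M} \<inter> {0..1}) \<noteq> {}"
      using that by (auto simp: a_def)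
    then show ?thesis by (auto intro: less_imp_le)
  qed
  interpret transport m n M N a
  proof
    show "j \<le> Suc j'" if ij: "i \<le> Suc i'" "i' \<le> Suc i" "0 < a i j" "0 < a i' j'" for i i' j j'
    proof -
      obtain x where x: "x \<in> {0..1}" "real i / N \<le> x" "x \<le> (real i + 1) / N" "real j / M \<le> f x"
        using a_pos[OF ij(3)] by blast
      obtain y where y: "y \<in> {0..1}" "real i' / N \<le> y" "y \<le> (real i' + 1) / N" "f y < (real j' + 1) / M"
        using a_pos[OF ij(4)] by blast
      have "(real i + 1) / N \<le> (real i' + 2) / N" "(real i' + 1) / N \<le> (real i + 2) / N"
        using ij(1,2) by (auto intro!: divide_right_mono)
      then have "\<bar>x - y\<bar> \<le> 2 / N" using x y by (simp add: add_divide_distrib)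
      also have "\<dots> < 3 / N" using N by (simp add: divide_strict_right_mono)
      finally have "dist (f x) (f y) < 1 / M" using e(2)[OF y(1) x(1)] Ne by (simp add: dist_real_def)
      then have "real j / M < (real j' + 2) / M"
        using x(4) y(4) by (simp add: dist_real_def add_divide_distrib)
      then have "real j < real j' + 2" using M by (simp add: divide_less_cancel)
      then show ?thesis by linarith
    qed
    show "M = 2 ^ m" "N = 2 ^ n" "m + 2 \<le> n" "\<And>i j. 0 \<le> a i j"
      by (simp_all add: M_def N_def n_def a_def)
    show "(\<Sum>j<M. a i j) = 1 / N" if "i < N" for i
      unfolding a_def by (rule C_lambda_matrix(1)[OF f M(1) N that])
    show "(\<Sum>i<N. a i j) = 1 / M" if "j < M" for j
      unfolding a_def by (rule C_lambda_matrix(2)[OF f M(1) N that])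
  qed
  obtain q L t h where z: "zigzag m q L t h" and close: "\<And>k. k < L \<Longrightarrow> \<exists>i<N. \<exists>s<M. 0 < a i s \<and>
     real i / N \<le> t k \<and> t (Suc k) \<le> (real i + 1) / N \<and>
     s \<le> Suc (min (h k) (h (Suc k))) \<and> min (h k) (h (Suc k)) \<le> s + 2"
    using exists_zigzag by blast
  interpret zigzag m q L t h by (fact z)
  have "\<bar>f x - g x\<bar> \<le> r" if x: "x \<in> {0..1}" for x
  proof -
    obtain k where k: "k < L" "x \<in> {t k..t (Suc k)}" using piece[OF x] .
    obtain i s where i: "0 < a i s" "real i / N \<le> t k" "t (Suc k) \<le> (real i + 1) / N"
      "s \<le> Suc (lev k)" "lev k \<le> s + 2"
      using close[OF k(1)] by (auto simp: lev_def)
    obtain y where y: "y \<in> {0..1}" "real i / N \<le> y" "y \<le> (real i + 1) / N"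
      "real s / M \<le> f y" "f y < (real s + 1) / M"
      using a_pos[OF i(1)] by blast
    have "\<bar>x - y\<bar> \<le> 1 / N" using k(2) i(2,3) y(2,3) unfolding atLeastAtMost_iff add_divide_distrib by linarith
    also have "\<dots> < 3 / N" using N by (simp add: divide_strict_right_mono)
    finally have d: "\<bar>f x - f y\<bar> < 1 / M" using e(2)[OF y(1) x] Ne by (simp add: dist_real_def)
    have "real (lev k) / M \<le> g x" "g x \<le> (real (lev k) + 1) / M"
      using val_piece_cell[OF k] g_eq[OF x] by (auto simp: cell_def M)
    moreover have "real s / M \<le> (real (lev k) + 1) / M" "(real (lev k) + 1) / M \<le> (real s + 3) / M"
      using i(4,5) by (auto intro!: divide_right_mono)
    ultimately have "\<bar>f x - g x\<bar> \<le> 4 / M"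
      using d y(4,5) by (simp add: add_divide_distrib)
    also have "4 / M \<le> r" using m M \<open>0 < r\<close> by (simp add: field_simps)
    finally show ?thesis .
  qed
  then show ?thesis using g_thompson by blast
qed

theorem theorem10:
  shows "mtopology_of C_lambda_metric closure_of thompson_monoid_LEO = C_lambda"
proof -
  have sub: "thompson_monoid_LEO \<subseteq> C_lambda"
    using thompson_monoid_subset_C_lambda by (auto simp: thompson_monoid_LEO_def)
  interpret Metric_space C_lambda "mdist C_lambda_metric"
    using Metric_space_mspace_mdist[of C_lambda_metric] by (simp add: mspace_C_lambda_metric)
  have "\<exists>g\<in>thompson_monoid_LEO. g \<in> mball f r" if f: "f \<in> C_lambda" and "0 < r" for f r
  proof -
    \<comment> \<open>Half the radius, because a pointwise bound passes to the supremum only as a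
      weak inequality.\<close>
    obtain g where g: "g \<in> thompson_monoid_LEO" "\<forall>x\<in>{0..1}. \<bar>f x - g x\<bar> \<le> r / 2"
      using thompson_LEO_approx[OF f, of "r / 2"] \<open>0 < r\<close> by auto
    have "mdist C_lambda_metric f g = (SUP x\<in>{0..1}. \<bar>f x - g x\<bar>)"
      using f g(1) sub by (intro mdist_C_lambda_metric) auto
    also have "\<dots> \<le> r / 2" using g(2) by (intro cSUP_least) auto
    finally show ?thesis using g(1) f sub \<open>0 < r\<close> by auto
  qed
  then have "mtopology closure_of thompson_monoid_LEO = C_lambda"
    unfolding metric_closure_of by auto
  then show ?thesis by (simp add: mtopology_of_def mspace_C_lambda_metric)
qed

end
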